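(* Let $\alpha>-\frac12$, $b>0$ and $f\in\mathcal{E}(\mathbb{R})$. The following two assertions are equivalent: 1. There exists a distribution $T\in\mathcal{E}'(\mathbb{R})$ with support included in $[-b,b]$ such that $f=\mathcal{F}_{B,S}^\alpha(T)$. 2. $f$ extends to an analytic function $\tilde f$ on $\mathbb{C}$ such that $$\exists\,m\in\mathbb{N},\ \exists\,c>0,\ \forall z\in\mathbb{C},\qquad |\tilde f(z)|\le c\,(1+|z|^2)^{\frac m2}\,e^{b|\mathrm{Im}(z)|}.$$
   Context: $\mathcal{E}(\mathbb{R})$ is the space of infinitely differentiable (complex-valued) functions on $\mathbb{R}$ with its usual topology, and $\mathcal{E}'(\mathbb{R})$ its dual, the space of distributions with compact support. For $\alpha>-\frac12$, the Bessel-Struve kernel is $S_\lambda^\alpha(x)=\frac{2\Gamma(\alpha+1)}{\sqrt\pi\,\Gamma(\alpha+\frac12)}\int_0^1(1-t^2)^{\alpha-\frac12}e^{\lambda xt}\,dt$. The Bessel-Struve transform of $T\in\mathcal{E}'(\mathbb{R})$ is $\mathcal{F}_{B,S}^\alpha(T)(\lambda)=\langle T,\,x\mapsto S_{-i\lambda}^\alpha(x)\rangle$, $\lambda\in\mathbb{R}$. *)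

theory Defs
  imports "HOL-Complex_Analysis.Complex_Analysis"
begin

definition nth_deriv :: "nat \<Rightarrow> (real \<Rightarrow> complex) \<Rightarrow> real \<Rightarrow> complex" where
  "nth_deriv k = (\<lambda>f x. vector_derivative f (at x)) ^^ k"

definition smooth_functions :: "(real \<Rightarrow> complex) set" where
  "smooth_functions = {f. \<forall>k x. nth_deriv k f differentiable (at x)}"

definition smooth_seminorm :: "real set \<Rightarrow> nat \<Rightarrow> (real \<Rightarrow> complex) \<Rightarrow> real" where
  "smooth_seminorm K k f = (SUP x\<in>K. norm (nth_deriv k f x))"

(* Uniform convergence of every derivative on every compact set.  K is required to be nonempty
   because the supremum of the empty set of reals is unspecified. *)
definition smooth_topology :: "(real \<Rightarrow> complex) topology" where
  "smooth_topology = topology_generated_by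
     {{g \<in> smooth_functions. smooth_seminorm K k (\<lambda>x. g x - f x) < e} | K k f e.
        compact K \<and> K \<noteq> {} \<and> f \<in> smooth_functions \<and> 0 < e}"

(* Distributions with compact support are the continuous linear functionals on the smooth
   functions.  They are modelled by functions on all of real => complex whose values outside
   smooth_functions are irrelevant. *)
definition compact_distributions :: "((real \<Rightarrow> complex) \<Rightarrow> complex) set" where
  "compact_distributions = {T.
     (\<forall>f\<in>smooth_functions. \<forall>g\<in>smooth_functions. T (\<lambda>x. f x + g x) = T f + T g) \<and>
     (\<forall>c. \<forall>f\<in>smooth_functions. T (\<lambda>x. c * f x) = c * T f) \<and>
     continuous_map smooth_topology euclidean T}"

definition test_functions :: "real set \<Rightarrow> (real \<Rightarrow> complex) set" where
  "test_functions U = {f \<in> smooth_functions.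
     compact (closure {x. f x \<noteq> 0}) \<and> closure {x. f x \<noteq> 0} \<subseteq> U}"

(* The complement of the largest open set on which T vanishes. *)
definition distribution_support :: "((real \<Rightarrow> complex) \<Rightarrow> complex) \<Rightarrow> real set" where
  "distribution_support T = - \<Union>{U. open U \<and> (\<forall>f\<in>test_functions U. T f = 0)}"

definition bessel_struve_kernel :: "real \<Rightarrow> complex \<Rightarrow> real \<Rightarrow> complex" where
  "bessel_struve_kernel \<alpha> l x =
     of_real (2 * Gamma (\<alpha> + 1) / (sqrt pi * Gamma (\<alpha> + 1/2))) *
     (LBINT t:{0..1}. of_real ((1 - t\<^sup>2) powr (\<alpha> - 1/2)) * exp (l * of_real x * of_real t))"

definition bessel_struve_transform ::
    "real \<Rightarrow> ((real \<Rightarrow> complex) \<Rightarrow> complex) \<Rightarrow> real \<Rightarrow> complex" where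
  "bessel_struve_transform \<alpha> T l = T (bessel_struve_kernel \<alpha> (- \<i> * of_real l))"

end

(*
  The monomials diagonalise everything: the kernel is sum_n c_n (l x)^n / n! with Beta integrals c_n,
  and a distribution can be applied term by term to an entire power series.

  From 1 to 2: cutting off at distance about 1/(1 + |z|) from [-b, b] bounds T applied to the kernel
  by a polynomial in |z| times exp(b |Im z|).

  From 2 to 1: the mean value phi(x) |-> int_0^1 w(t) phi(x t) dt with an Erdelyi-Kober weight w
  multiplies x^n by a factor d_n such that c_n d_n times the Pochhammer symbol of (n+1)/2 of a fixed
  length N is constant. Multiplying the n-th Taylor coefficient of F by this Pochhammer symbol amounts
  to N first order Euler operators and preserves the growth condition, so the classical
  Paley-Wiener-Schwartz theorem gives a distribution S whose Fourier transform is the new function,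
  and T is S composed with the mean value. The classical theorem is reduced, by repeatedly subtracting
  a multiple of sin(bz)/(bz) and dividing by z, to functions decaying quadratically on the real line.
  For these the inversion formula needs only Cauchy's theorem: of the two exponentials produced by
  int_{-b}^b one is bounded in the upper and the other in the lower half plane.
*)

theory Submission
  imports Defs
begin

section \<open>Calculus of smooth functions\<close>

text \<open>The kernel is a fractional integral of exponentials, of order \<alpha> + 1/2 in the
  variable t^2, so undoing it asks for a derivative of that order, which is in general fractional.
  The order is split as N - \<beta>: the fractional integration of order \<beta> acts on test
  functions, where averaging over [0, 1] keeps smoothness and the interval [-b, b], and the N
  integer derivatives act on F, where they cost only powers of |z|. In Gamma factors, c_n is a
  multiple of Gamma((n+1)/2) / Gamma(n/2+\<alpha>+1) and d_n one of Gamma(n/2+\<alpha>+1) /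
  Gamma(n/2+\<alpha>+1+\<beta>). With \<beta> = N - \<alpha> - 1/2 their product is a multiple of
  Gamma((n+1)/2) / Gamma((n+1)/2+N), the reciprocal of a Pochhammer symbol. The support is the other
  obstacle: continuity bounds T by seminorms over some possibly larger interval [-R, R]. From 1 to 2
  this interval has to be shrunk towards [-b, b]; from 2 to 1 every functional is built with a bound
  over [-b, b] itself.\<close>

lemma nth_deriv_0 [simp]: "nth_deriv 0 f = f"
  by (simp add: nth_deriv_def)

lemma nth_deriv_Suc: "nth_deriv (Suc k) f x = vector_derivative (nth_deriv k f) (at x)"
  by (simp add: nth_deriv_def)

lemma nth_deriv_add: "nth_deriv j (nth_deriv k f) = nth_deriv (j + k) f"
  by (simp add: nth_deriv_def funpow_add)

lemma smooth_deriv: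
  assumes "f \<in> smooth_functions"
  shows "(nth_deriv k f has_vector_derivative nth_deriv (Suc k) f x) (at x)"
  using assms unfolding nth_deriv_Suc smooth_functions_def
  by (auto simp: vector_derivative_works[symmetric])

lemma smooth_nth_deriv:
  "f \<in> smooth_functions \<Longrightarrow> nth_deriv k f \<in> smooth_functions"
  by (auto simp: smooth_functions_def nth_deriv_add)

lemma smooth_nth_deriv_continuous:
  assumes "f \<in> smooth_functions"
  shows "continuous_on S (nth_deriv k f)"
  by (meson assms continuous_at_imp_continuous_on has_vector_derivative_continuous smooth_deriv)

lemma smooth_continuous:
  assumes "f \<in> smooth_functions"
  shows "continuous_on S f"
  using smooth_nth_deriv_continuous[OF assms, where k = 0] by simp

text \<open>\<open>nth_deriv\<close> iterates \<open>vector_derivative\<close>, which is meaningful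
  only where a derivative exists. A guessed sequence \<open>d\<close>, each term the derivative of
  the one before, settles the values and the smoothness at once; the closed forms below are obtained
  this way.\<close>

lemma derivative_sequence:
  assumes "\<And>x. d 0 x = f x"
    and "\<And>k x. (d k has_vector_derivative d (Suc k) x) (at x)"
  shows nth_deriv_eqI: "nth_deriv k f = d k"
    and smoothI: "f \<in> smooth_functions"
proof -
  have eq: "nth_deriv k f = d k" for k
  proof (induction k)
    case 0
    then show ?case using assms(1) by auto
  next
    case (Suc k)
    then show ?case
      using vector_derivative_at[OF assms(2)] by (auto simp: nth_deriv_Suc)
  qed
  show "nth_deriv k f = d k" by (rule eq)
  show "f \<in> smooth_functions"
    unfolding smooth_functions_def using assms(2) eq
    by (auto intro: differentiableI_vector)
qed

lemma
  assumes "f \<in> smooth_functions" "g \<in> smooth_functions"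
  shows nth_deriv_plus: "nth_deriv k (\<lambda>x. f x + g x) = (\<lambda>x. nth_deriv k f x + nth_deriv k g x)"
    and smooth_plus: "(\<lambda>x. f x + g x) \<in> smooth_functions"
  by (rule derivative_sequence[where d = "\<lambda>k x. nth_deriv k f x + nth_deriv k g x"];
      auto intro!: has_vector_derivative_add smooth_deriv assms)+

lemma
  assumes "f \<in> smooth_functions"
  shows nth_deriv_scale: "nth_deriv k (\<lambda>x. c * f x) = (\<lambda>x. c * nth_deriv k f x)"
    and smooth_scale: "(\<lambda>x. c * f x) \<in> smooth_functions"
  by (rule derivative_sequence[where d = "\<lambda>k x. c * nth_deriv k f x"];
      auto intro!: has_vector_derivative_mult_right smooth_deriv assms)+

lemma smooth_minus:
  assumes "f \<in> smooth_functions" "g \<in> smooth_functions"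
  shows "(\<lambda>x. f x - g x) \<in> smooth_functions"
  by (rule smoothI[where d = "\<lambda>k x. nth_deriv k f x - nth_deriv k g x"])
     (auto intro!: has_vector_derivative_diff smooth_deriv assms)

lemma
  shows nth_deriv_const: "nth_deriv k (\<lambda>x. c) = (\<lambda>x. if k = 0 then c else 0)"
    and smooth_const: "(\<lambda>x. c) \<in> smooth_functions"
  by (rule derivative_sequence[where d = "\<lambda>k x. if k = 0 then c else 0"]; auto)+

lemma
  fixes a b :: real
  assumes "f \<in> smooth_functions"
  shows nth_deriv_affine:
      "nth_deriv k (\<lambda>x. f (a * x + b)) = (\<lambda>x. of_real a ^ k * nth_deriv k f (a * x + b))"
    and smooth_affine: "(\<lambda>x. f (a * x + b)) \<in> smooth_functions"
proof -
  have d: "((\<lambda>x. of_real a ^ k * nth_deriv k f (a * x + b)) has_vector_derivative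
      of_real a ^ Suc k * nth_deriv (Suc k) f (a * x + b)) (at x)" for k x
  proof -
    have "((\<lambda>x. a * x + b) has_vector_derivative a) (at x)"
      by (auto intro!: derivative_eq_intros
          simp: has_real_derivative_iff_has_vector_derivative[symmetric])
    from vector_diff_chain_at[OF this smooth_deriv[OF assms]]
    have "((\<lambda>x. nth_deriv k f (a * x + b)) has_vector_derivative
      of_real a * nth_deriv (Suc k) f (a * x + b)) (at x)"
      by (simp add: o_def scaleR_conv_of_real)
    from has_vector_derivative_mult_right[OF this, of "of_real a ^ k"]
    show ?thesis by (simp only: power_Suc2 mult.assoc)
  qed
  show "nth_deriv k (\<lambda>x. f (a * x + b)) = (\<lambda>x. of_real a ^ k * nth_deriv k f (a * x + b))"
    by (rule nth_deriv_eqI[where d = "\<lambda>k x. of_real a ^ k * nth_deriv k f (a * x + b)"]) (use d in auto)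
  show "(\<lambda>x. f (a * x + b)) \<in> smooth_functions"
    by (rule smoothI[where d = "\<lambda>k x. of_real a ^ k * nth_deriv k f (a * x + b)"]) (use d in auto)
qed

text \<open>This recursion gives the \<open>k\<close>-th derivative of a product without binomial coefficients.\<close>

fun leibniz :: "nat \<Rightarrow> (real \<Rightarrow> complex) \<Rightarrow> (real \<Rightarrow> complex) \<Rightarrow> real \<Rightarrow> complex" where
  "leibniz 0 f g x = f x * g x"
| "leibniz (Suc k) f g x = leibniz k (nth_deriv 1 f) g x + leibniz k f (nth_deriv 1 g) x"

lemma leibniz_deriv:
  assumes "f \<in> smooth_functions" "g \<in> smooth_functions"
  shows "(leibniz k f g has_vector_derivative leibniz (Suc k) f g x) (at x)"
  using assms
proof (induction k arbitrary: f g)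
  case 0
  have "((\<lambda>x. f x * g x) has_vector_derivative f x * nth_deriv 1 g x + nth_deriv 1 f x * g x) (at x)"
    using has_vector_derivative_mult[OF smooth_deriv[OF 0(1), where k = 0] smooth_deriv[OF 0(2), where k = 0]]
    by simp
  moreover have "leibniz 0 f g = (\<lambda>x. f x * g x)" by auto
  ultimately show ?case by (simp add: add.commute)
next
  case (Suc k)
  have "((\<lambda>x. leibniz k (nth_deriv 1 f) g x + leibniz k f (nth_deriv 1 g) x) has_vector_derivative
     leibniz (Suc k) (nth_deriv 1 f) g x + leibniz (Suc k) f (nth_deriv 1 g) x) (at x)"
    by (intro has_vector_derivative_add Suc smooth_nth_deriv)
  moreover have "leibniz (Suc k) f g =
      (\<lambda>x. leibniz k (nth_deriv 1 f) g x + leibniz k f (nth_deriv 1 g) x)" by auto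
  ultimately show ?case by simp
qed

lemma
  assumes "f \<in> smooth_functions" "g \<in> smooth_functions"
  shows nth_deriv_mult: "nth_deriv k (\<lambda>x. f x * g x) = leibniz k f g"
    and smooth_mult: "(\<lambda>x. f x * g x) \<in> smooth_functions"
  using leibniz_deriv[OF assms]
  by (intro derivative_sequence[where d = "\<lambda>k. leibniz k f g"]; simp del: leibniz.simps(2))+

text \<open>Bounds of the shape \<open>A * B ^ j\<close> are stable under the recursion, since
  differentiating a factor replaces its \<open>A\<close> by \<open>A * B\<close>. The number of
  terms doubles at each order, whence the 2 in the base.\<close>

lemma nth_deriv_mult_bound:
  assumes "f \<in> smooth_functions" "g \<in> smooth_functions" "A \<ge> 0" "A' \<ge> 0" "B \<ge> 0"
    and "\<And>j. j \<le> k \<Longrightarrow> norm (nth_deriv j f x) \<le> A * B ^ j"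
    and "\<And>j. j \<le> k \<Longrightarrow> norm (nth_deriv j g x) \<le> A' * B ^ j"
  shows "norm (nth_deriv k (\<lambda>x. f x * g x) x) \<le> A * A' * (2 * B) ^ k"
proof -
  have "norm (leibniz k f g x) \<le> A * A' * (2 * B) ^ k"
    using assms
  proof (induction k arbitrary: f g A A')
    case 0
    from "0.prems"(6,7)[of 0] show ?case
      using "0.prems" by (auto simp: norm_mult intro!: mult_mono)
  next
    case (Suc k)
    have 1: "norm (leibniz k (nth_deriv 1 f) g x) \<le> (A * B) * A' * (2 * B) ^ k"
    proof (rule Suc.IH)
      fix j assume "j \<le> k"
      then show "norm (nth_deriv j (nth_deriv 1 f) x) \<le> A * B * B ^ j"
        using Suc.prems(6)[of "Suc j"] by (simp add: nth_deriv_add algebra_simps)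
    qed (use Suc.prems in \<open>auto intro: smooth_nth_deriv\<close>)
    have 2: "norm (leibniz k f (nth_deriv 1 g) x) \<le> A * (A' * B) * (2 * B) ^ k"
    proof (rule Suc.IH)
      fix j assume "j \<le> k"
      then show "norm (nth_deriv j (nth_deriv 1 g) x) \<le> A' * B * B ^ j"
        using Suc.prems(7)[of "Suc j"] by (simp add: nth_deriv_add algebra_simps)
    qed (use Suc.prems in \<open>auto intro: smooth_nth_deriv\<close>)
    have "norm (leibniz (Suc k) f g x) \<le> (A * B) * A' * (2 * B) ^ k + A * (A' * B) * (2 * B) ^ k"
      using 1 2 norm_triangle_mono by fastforce
    then show ?case by (simp add: algebra_simps)
  qed
  then show ?thesis by (simp add: nth_deriv_mult assms)
qed

text \<open>Derivatives depend on the germ only. This evaluates them wherever a function is constant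
  near a point, in particular beyond a cutoff.\<close>

lemma nth_deriv_cong_open:
  assumes "open U" "x \<in> U" "\<And>y. y \<in> U \<Longrightarrow> f y = g y"
  shows "nth_deriv k f x = nth_deriv k g x"
  using assms(2)
proof (induction k arbitrary: x)
  case 0
  then show ?case using assms by simp
next
  case (Suc k)
  have ev: "eventually (\<lambda>y. nth_deriv k f y = nth_deriv k g y) (nhds x)"
    using Suc assms(1) eventually_nhds by blast
  show ?case unfolding nth_deriv_Suc
    by (rule vector_derivative_cong_eq) (use ev Suc in \<open>auto\<close>)
qed

section \<open>Functionals bounded by finitely many seminorms\<close>

text \<open>Continuity as a seminorm estimate, with an arbitrary common bound \<open>B\<close> in
  place of suprema. With \<open>R\<close> equal to \<open>b\<close> it also encodes the support
  condition, see \<open>bounded_imp_support\<close>.\<close>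

definition seminorm_bounded :: "((real \<Rightarrow> complex) \<Rightarrow> complex) \<Rightarrow> real \<Rightarrow> nat \<Rightarrow> real \<Rightarrow> bool" where
  "seminorm_bounded T R m C \<longleftrightarrow>
     (\<forall>f\<in>smooth_functions. \<forall>B. (\<forall>k\<le>m. \<forall>x\<in>{-R..R}. norm (nth_deriv k f x) \<le> B) \<longrightarrow> norm (T f) \<le> C * B)"

lemma seminorm_boundedD:
  assumes "seminorm_bounded T R m C" "f \<in> smooth_functions"
    and "\<And>k x. k \<le> m \<Longrightarrow> x \<in> {-R..R} \<Longrightarrow> norm (nth_deriv k f x) \<le> B"
  shows "norm (T f) \<le> C * B"
  using assms unfolding seminorm_bounded_def by blast

definition linear_functional :: "((real \<Rightarrow> complex) \<Rightarrow> complex) \<Rightarrow> bool" where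
  "linear_functional T \<longleftrightarrow>
     (\<forall>f\<in>smooth_functions. \<forall>g\<in>smooth_functions. T (\<lambda>x. f x + g x) = T f + T g) \<and>
     (\<forall>c. \<forall>f\<in>smooth_functions. T (\<lambda>x. c * f x) = c * T f)"

lemma linear_functional_add:
  "linear_functional T \<Longrightarrow> f \<in> smooth_functions \<Longrightarrow> g \<in> smooth_functions \<Longrightarrow>
    T (\<lambda>x. f x + g x) = T f + T g"
  and linear_functional_scale:
  "linear_functional T \<Longrightarrow> f \<in> smooth_functions \<Longrightarrow> T (\<lambda>x. c * f x) = c * T f"
  by (auto simp: linear_functional_def)

lemma linear_functional_zero: "linear_functional T \<Longrightarrow> T (\<lambda>x. 0) = 0"
  using linear_functional_scale[OF _ smooth_const[of 0], of T 0] by simp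

lemma linear_functional_diff:
  assumes "linear_functional T" "f \<in> smooth_functions" "g \<in> smooth_functions"
  shows "T (\<lambda>x. f x - g x) = T f - T g"
  using linear_functional_add[OF assms(1,2) smooth_scale[OF assms(3), of "-1"]]
    linear_functional_scale[OF assms(1,3), of "-1"] by simp

lemma
  assumes "finite I" "\<And>i. i \<in> I \<Longrightarrow> f i \<in> smooth_functions"
  shows smooth_sum: "(\<lambda>x. \<Sum>i\<in>I. f i x) \<in> smooth_functions"
    and linear_functional_sum: "linear_functional T \<Longrightarrow> T (\<lambda>x. \<Sum>i\<in>I. f i x) = (\<Sum>i\<in>I. T (f i))"
  using assms
proof (induction I rule: finite_induct)
  case empty
  { case 1 then show ?case by (simp add: smooth_const) }
  { case 2 then show ?case by (simp add: linear_functional_zero) }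
next
  case (insert i I)
  { case 1 with insert show ?case by (auto intro!: smooth_plus) }
  { case 2
    then have "T (\<lambda>x. f i x + (\<Sum>i\<in>I. f i x)) = T (f i) + T (\<lambda>x. \<Sum>i\<in>I. f i x)"
      using insert by (intro linear_functional_add) auto
    with 2 insert show ?case by simp }
qed

lemma basic_open:
  assumes "compact K" "K \<noteq> {}" "f \<in> smooth_functions" "0 < e"
  shows "openin smooth_topology {g \<in> smooth_functions. smooth_seminorm K k (\<lambda>x. g x - f x) < e}"
  unfolding smooth_topology_def openin_topology_generated_by_iff
  by (rule generate_topology_on.Basis) (use assms in blast)

lemma smooth_seminorm_zero: "K \<noteq> {} \<Longrightarrow> smooth_seminorm K k (\<lambda>x. 0) = 0"
  by (simp add: smooth_seminorm_def nth_deriv_const)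

lemma smooth_seminorm_ge:
  assumes "compact K" "f \<in> smooth_functions" "x \<in> K"
  shows "norm (nth_deriv k f x) \<le> smooth_seminorm K k f"
proof -
  have "compact ((\<lambda>x. norm (nth_deriv k f x)) ` K)"
    by (intro compact_continuous_image continuous_on_norm smooth_nth_deriv_continuous assms)
  then have "bdd_above ((\<lambda>x. norm (nth_deriv k f x)) ` K)"
    by (simp add: bounded_imp_bdd_above compact_imp_bounded)
  then show ?thesis unfolding smooth_seminorm_def using assms by (auto intro: cSUP_upper)
qed

lemma smooth_seminorm_le:
  assumes "K \<noteq> {}" "\<And>x. x \<in> K \<Longrightarrow> norm (nth_deriv k f x) \<le> B"
  shows "smooth_seminorm K k f \<le> B"
  unfolding smooth_seminorm_def using assms by (auto intro: cSUP_least)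

lemma topspace_smooth_topology: "topspace smooth_topology = smooth_functions"
proof -
  have "f \<in> topspace smooth_topology" if f: "f \<in> smooth_functions" for f
    using openin_subset[OF basic_open[OF compact_sing[of 0] _ f zero_less_one, of 0]] f
    by (auto simp: smooth_seminorm_zero)
  moreover have "topspace smooth_topology \<subseteq> smooth_functions"
    unfolding smooth_topology_def topology_generated_by_topspace by auto
  ultimately show ?thesis by blast
qed

text \<open>Induction along the generation of the topology. The subbasic case has the content: a
  subbasic set containing 0 need not be centred at 0, so its slack at 0 has to absorb a triangle
  inequality.\<close>

lemma open_zero_nhd:
  assumes "openin smooth_topology U" "(\<lambda>x. 0) \<in> U"
  shows "\<exists>R>0. \<exists>m. \<exists>d>0. \<forall>f\<in>smooth_functions.
     (\<forall>k\<le>m. \<forall>x\<in>{-R..R}. norm (nth_deriv k f x) \<le> d) \<longrightarrow> f \<in> U"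
proof -
  have "generate_topology_on
     {{g \<in> smooth_functions. smooth_seminorm K k (\<lambda>x. g x - f x) < e} | K k f e.
        compact K \<and> K \<noteq> {} \<and> f \<in> smooth_functions \<and> 0 < e} U"
    using assms(1) unfolding smooth_topology_def openin_topology_generated_by_iff .
  then show ?thesis using assms(2)
  proof (induction rule: generate_topology_on.induct)
    case Empty
    then show ?case by simp
  next
    case (Int a b)
    from Int.IH(1) Int.prems obtain R m d where
      1: "R > 0" "d > 0" "\<And>f. f\<in>smooth_functions \<Longrightarrow>
        (\<forall>k\<le>m. \<forall>x\<in>{-R..R}. norm (nth_deriv k f x) \<le> d) \<Longrightarrow> f \<in> a"
      by (metis IntD1)
    from Int.IH(2) Int.prems obtain R' m' d' where
      2: "R' > 0" "d' > 0" "\<And>f. f\<in>smooth_functions \<Longrightarrow>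
        (\<forall>k\<le>m'. \<forall>x\<in>{-R'..R'}. norm (nth_deriv k f x) \<le> d') \<Longrightarrow> f \<in> b"
      by (metis IntD2)
    have "f \<in> a \<inter> b" if f: "f \<in> smooth_functions"
      and le: "\<forall>k\<le>max m m'. \<forall>x\<in>{-max R R'..max R R'}. norm (nth_deriv k f x) \<le> min d d'" for f
    proof
      show "f \<in> a"
      proof (rule 1(3)[OF f], intro allI impI ballI)
        fix k x assume "k \<le> m" "x \<in> {-R..R}"
        then have "k \<le> max m m'" "x \<in> {-max R R'..max R R'}" by auto
        with le have "norm (nth_deriv k f x) \<le> min d d'" by blast
        then show "norm (nth_deriv k f x) \<le> d" by simp
      qed
      show "f \<in> b"
      proof (rule 2(3)[OF f], intro allI impI ballI)
        fix k x assume "k \<le> m'" "x \<in> {-R'..R'}"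
        then have "k \<le> max m m'" "x \<in> {-max R R'..max R R'}" by auto
        with le have "norm (nth_deriv k f x) \<le> min d d'" by blast
        then show "norm (nth_deriv k f x) \<le> d'" by simp
      qed
    qed
    moreover have "max R R' > 0" "min d d' > 0" using 1 2 by auto
    ultimately show ?case by blast
  next
    case (UN K)
    then obtain k where k: "k \<in> K" "(\<lambda>x. 0) \<in> k" by blast
    from UN.IH[OF this] obtain R m d where "R > 0" "d > 0" "\<forall>f\<in>smooth_functions.
        (\<forall>k\<le>m. \<forall>x\<in>{-R..R}. norm (nth_deriv k f x) \<le> d) \<longrightarrow> f \<in> k"
      by blast
    with k(1) show ?case by (meson UnionI)
  next
    case (Basis s)
    then obtain K k f e where s: "s = {g \<in> smooth_functions. smooth_seminorm K k (\<lambda>x. g x - f x) < e}"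
      and K: "compact K" "K \<noteq> {}" and f: "f \<in> smooth_functions" "0 < e" by blast
    from compact_imp_bounded[OF K(1)] obtain R where "R > 0" "\<forall>x\<in>K. norm x \<le> R"
      unfolding bounded_pos by blast
    then have R: "R > 0" "K \<subseteq> {-R..R}" by force+
    have less: "smooth_seminorm K k (\<lambda>x. 0 - f x) < e" using Basis s by simp
    \<comment> \<open>Half the slack, because \<open>g\<close> satisfies a non-strict bound and
      \<open>s\<close> asks for a strict one.\<close>
    define d where "d = (e - smooth_seminorm K k (\<lambda>x. 0 - f x)) / 2"
    have d: "d > 0" using less by (simp add: d_def)
    have mf: "(\<lambda>x. 0 - f x) \<in> smooth_functions" using smooth_minus[OF smooth_const f(1)] .
    have "g \<in> s" if g: "g \<in> smooth_functions"
      and le: "\<forall>j\<le>k. \<forall>x\<in>{-R..R}. norm (nth_deriv j g x) \<le> d" for g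
    proof -
      have "smooth_seminorm K k (\<lambda>x. g x - f x) \<le> d + smooth_seminorm K k (\<lambda>x. 0 - f x)"
      proof (rule smooth_seminorm_le[OF K(2)])
        fix x assume x: "x \<in> K"
        have "nth_deriv k (\<lambda>x. g x - f x) x = nth_deriv k g x + nth_deriv k (\<lambda>x. 0 - f x) x"
          using nth_deriv_plus[OF g mf, of k] by simp
        also have "norm \<dots> \<le> d + smooth_seminorm K k (\<lambda>x. 0 - f x)"
          using smooth_seminorm_ge[OF K(1) mf x, of k] le x R by (intro norm_triangle_mono) auto
        finally show "norm (nth_deriv k (\<lambda>x. g x - f x) x) \<le> d + smooth_seminorm K k (\<lambda>x. 0 - f x)" .
      qed
      also have "\<dots> < e" using less by (simp add: d_def field_simps)
      finally show ?thesis using g by (simp add: s)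
    qed
    then show ?case using R(1) d by blast
  qed
qed

lemma compact_distributions_linear: "T \<in> compact_distributions \<Longrightarrow> linear_functional T"
  by (simp add: compact_distributions_def linear_functional_def)

lemma compact_distribution_bounded:
  assumes T: "T \<in> compact_distributions"
  obtains R m C where "R > 0" "C \<ge> 0" "seminorm_bounded T R m C"
proof -
  have lin: "linear_functional T" by (rule compact_distributions_linear[OF T])
  have cont: "continuous_map smooth_topology euclidean T"
    using T by (simp add: compact_distributions_def)
  define U where "U = {f \<in> topspace smooth_topology. T f \<in> ball 0 1}"
  have "openin smooth_topology U"
    unfolding U_def by (rule openin_continuous_map_preimage[OF cont]) auto
  moreover have "(\<lambda>x. 0) \<in> U"
    by (simp add: U_def topspace_smooth_topology smooth_const linear_functional_zero[OF lin])
  ultimately have "\<exists>R>0. \<exists>m. \<exists>d>0. \<forall>f\<in>smooth_functions.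
     (\<forall>k\<le>m. \<forall>x\<in>{-R..R}. norm (nth_deriv k f x) \<le> d) \<longrightarrow> f \<in> U"
    by (rule open_zero_nhd)
  then obtain R m d where R: "R > 0" "d > 0"
    and "\<forall>f\<in>smooth_functions. (\<forall>k\<le>m. \<forall>x\<in>{-R..R}. norm (nth_deriv k f x) \<le> d) \<longrightarrow> f \<in> U"
    by blast
  then have *: "\<And>f. f \<in> smooth_functions \<Longrightarrow>
      \<forall>k\<le>m. \<forall>x\<in>{-R..R}. norm (nth_deriv k f x) \<le> d \<Longrightarrow> norm (T f) < 1"
    by (simp add: U_def)
  \<comment> \<open>Homogeneity: scaling by \<open>d / B\<close> moves \<open>f\<close> into the
    neighbourhood. This needs \<open>B > 0\<close>.\<close>
  have pos: "norm (T f) \<le> (1/d) * B" if f: "f \<in> smooth_functions"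
    and B: "\<forall>k\<le>m. \<forall>x\<in>{-R..R}. norm (nth_deriv k f x) \<le> B" "B > 0" for f B
  proof -
    have "norm (T (\<lambda>x. of_real (d / B) * f x)) < 1"
    proof (rule *)
      show "\<forall>k\<le>m. \<forall>x\<in>{-R..R}. norm (nth_deriv k (\<lambda>x. of_real (d / B) * f x) x) \<le> d"
      proof (intro allI impI ballI)
        fix k x assume "k \<le> m" "x \<in> {-R..R}"
        then have "norm (nth_deriv k f x) * d \<le> B * d" using B R(2) by auto
        then show "norm (nth_deriv k (\<lambda>x. of_real (d / B) * f x) x) \<le> d"
          using R(2) B(2) unfolding nth_deriv_scale[OF f]
          by (simp add: norm_mult norm_divide field_simps)
      qed
    qed (rule smooth_scale[OF f])
    then show ?thesis
      using R(2) B(2) unfolding linear_functional_scale[OF lin f]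
      by (simp add: norm_mult norm_divide field_simps)
  qed
  have "seminorm_bounded T R m (1/d)"
    unfolding seminorm_bounded_def
  proof (intro ballI allI impI)
    fix f B assume f: "f \<in> smooth_functions"
      and B: "\<forall>k\<le>m. \<forall>x\<in>{-R..R}. norm (nth_deriv k f x) \<le> B"
    have "norm (nth_deriv 0 f 0) \<le> B" using B R(1) by fastforce
    then have B0: "B \<ge> 0" using norm_ge_zero order_trans by blast
    \<comment> \<open>\<open>B\<close> may be 0, so \<open>pos\<close> is applied to
      \<open>B + d * e\<close>, which costs only \<open>e\<close>.\<close>
    show "norm (T f) \<le> 1 / d * B"
    proof (rule field_le_epsilon)
      fix e :: real assume e: "e > 0"
      have "norm (T f) \<le> (1/d) * (B + d * e)"
      proof (rule pos[OF f])
        show "\<forall>k\<le>m. \<forall>x\<in>{-R..R}. norm (nth_deriv k f x) \<le> B + d * e"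
          using B R(2) e by (smt (verit) mult_pos_pos)
        show "B + d * e > 0" using B0 R(2) e by (simp add: add_nonneg_pos)
      qed
      then show "norm (T f) \<le> 1 / d * B + e" using R(2) by (simp add: field_simps)
    qed
  qed
  then show ?thesis using that R by (meson less_imp_le zero_less_divide_1_iff)
qed

lemma bounded_imp_compact_distribution:
  assumes lin: "linear_functional T" and "R > 0" and bd: "seminorm_bounded T R m C"
  shows "T \<in> compact_distributions"
proof -
  \<comment> \<open>\<open>C\<close> comes without a sign; the choice of the radius below divides by
    a positive constant.\<close>
  define C' where "C' = \<bar>C\<bar> + 1"
  have C': "C' > 0" by (simp add: C'_def)
  have bd': "norm (T f) \<le> C' * B" if "f \<in> smooth_functions"
    "\<And>k x. k \<le> m \<Longrightarrow> x\<in>{-R..R} \<Longrightarrow> norm (nth_deriv k f x) \<le> B" for f B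
  proof -
    have "norm (nth_deriv 0 f 0) \<le> B" using that(2)[of 0 0] assms by simp
    then have "B \<ge> 0" using norm_ge_zero order_trans by blast
    have "norm (T f) \<le> C * B" using bd that unfolding seminorm_bounded_def by blast
    also have "\<dots> \<le> C' * B" using \<open>B \<ge> 0\<close> by (intro mult_right_mono) (auto simp: C'_def)
    finally show ?thesis .
  qed
  have "continuous_map smooth_topology euclidean T"
    unfolding continuous_map_def
  proof (intro conjI allI impI)
    fix V :: "complex set" assume "openin euclidean V"
    then have V: "open V" by simp
    show "openin smooth_topology {x \<in> topspace smooth_topology. T x \<in> V}"
    proof (subst openin_subopen, intro ballI)
      fix f assume "f \<in> {x \<in> topspace smooth_topology. T x \<in> V}"
      then have f: "f \<in> smooth_functions" "T f \<in> V" by (auto simp: topspace_smooth_topology)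
      from V f(2) obtain e where e: "e > 0" "ball (T f) e \<subseteq> V" by (meson open_contains_ball)
      define d where "d = e / (2 * C')"
      have d: "d > 0" using C' e by (simp add: d_def)
      define W where "W = (\<Inter>k\<in>{..m}. {g \<in> smooth_functions. smooth_seminorm {-R..R} k (\<lambda>x. g x - f x) < d})"
      have "openin smooth_topology W" unfolding W_def
        by (intro openin_INT2 basic_open) (use f d assms in auto)
      moreover have "f \<in> W" unfolding W_def
        using f d assms by (auto simp: smooth_seminorm_zero)
      moreover have "g \<in> {x \<in> topspace smooth_topology. T x \<in> V}" if g: "g \<in> W" for g
      proof -
        have gs: "g \<in> smooth_functions" using g by (auto simp: W_def)
        have s: "(\<lambda>x. g x - f x) \<in> smooth_functions" by (rule smooth_minus[OF gs f(1)])
        have "norm (T (\<lambda>x. g x - f x)) \<le> C' * d"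
        proof (rule bd'[OF s])
          fix k x assume k: "k \<le> m" and x: "x \<in> {-R..R}"
          have "norm (nth_deriv k (\<lambda>x. g x - f x) x) \<le> smooth_seminorm {-R..R} k (\<lambda>x. g x - f x)"
            by (rule smooth_seminorm_ge[OF _ s x]) simp
          also have "\<dots> < d" using g k by (auto simp: W_def)
          finally show "norm (nth_deriv k (\<lambda>x. g x - f x) x) \<le> d" by simp
        qed
        also have "\<dots> < e" using e C' by (simp add: d_def)
        finally have "T g \<in> ball (T f) e"
          by (simp add: linear_functional_diff[OF lin gs f(1)] dist_norm norm_minus_commute)
        then show ?thesis using e gs by (auto simp: topspace_smooth_topology)
      qed
      ultimately show "\<exists>W. openin smooth_topology W \<and> f \<in> W \<and> W \<subseteq> {x \<in> topspace smooth_topology. T x \<in> V}"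
        by blast
    qed
  qed simp
  then show ?thesis using lin by (simp add: compact_distributions_def linear_functional_def)
qed

text \<open>A test function supported off [-b, b] vanishes near each point of that interval, so
  every seminorm in the bound is 0. It matters that the bound is over [-b, b] and not over a
  neighbourhood of it.\<close>

lemma bounded_imp_support:
  assumes "seminorm_bounded T b m C"
  shows "distribution_support T \<subseteq> {-b..b}"
proof -
  have "T f = 0" if f: "f \<in> test_functions (- {-b..b})" for f
  proof -
    let ?U = "- closure {x. f x \<noteq> 0}"
    have fs: "f \<in> smooth_functions" and sub: "{-b..b} \<subseteq> ?U"
      using f by (auto simp: test_functions_def)
    have "nth_deriv k f x = 0" if "x \<in> {-b..b}" for k x
    proof -
      have "nth_deriv k f x = nth_deriv k (\<lambda>x. 0) x"
        by (rule nth_deriv_cong_open[of ?U]) (use that sub closure_subset[of "{x. f x \<noteq> 0}"] in auto)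
      then show ?thesis by (simp add: nth_deriv_const)
    qed
    then have "norm (T f) \<le> C * 0"
      using assms fs unfolding seminorm_bounded_def by (metis norm_zero order_refl)
    then show ?thesis by simp
  qed
  then have "- {-b..b} \<in> {U. open U \<and> (\<forall>f\<in>test_functions U. T f = 0)}"
    by auto
  then show ?thesis unfolding distribution_support_def by blast
qed

section \<open>Entire power series under a distribution\<close>

lemma summable_diffs_funpow:
  fixes e :: "nat \<Rightarrow> complex"
  assumes "\<And>z. summable (\<lambda>n. e n * z ^ n)"
  shows "summable (\<lambda>n. (diffs ^^ k) e n * z ^ n)"
proof (induction k arbitrary: z)
  case 0
  then show ?case using assms by simp
next
  case (Suc k)
  then show ?case by (simp add: termdiff_converges_all)
qed

lemma
  fixes e :: "nat \<Rightarrow> complex"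
  assumes "\<And>z. summable (\<lambda>n. e n * z ^ n)"
  shows nth_deriv_power_series:
      "nth_deriv k (\<lambda>x. \<Sum>n. e n * of_real x ^ n) = (\<lambda>x. \<Sum>n. (diffs ^^ k) e n * of_real x ^ n)"
    and smooth_power_series: "(\<lambda>x. \<Sum>n. e n * of_real x ^ n) \<in> smooth_functions"
proof -
  let ?d = "\<lambda>k x. \<Sum>n. (diffs ^^ k) e n * complex_of_real x ^ n"
  have d: "(?d k has_vector_derivative ?d (Suc k) x) (at x)" for k x
  proof -
    have "((\<lambda>z. \<Sum>n. (diffs ^^ k) e n * z ^ n) has_field_derivative
        (\<Sum>n. diffs ((diffs ^^ k) e) n * of_real x ^ n)) (at (of_real x))"
      by (rule termdiffs_strong_converges_everywhere) (rule summable_diffs_funpow[OF assms])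
    from has_vector_derivative_real_field[OF this] show ?thesis by simp
  qed
  show "nth_deriv k (\<lambda>x. \<Sum>n. e n * of_real x ^ n) = ?d k"
    by (rule nth_deriv_eqI[where d = ?d]) (use d in auto)
  show "(\<lambda>x. \<Sum>n. e n * of_real x ^ n) \<in> smooth_functions"
    by (rule smoothI[where d = ?d]) (use d in auto)
qed

lemma smooth_monomial: "(\<lambda>x. of_real x ^ n) \<in> smooth_functions"
proof -
  let ?e = "\<lambda>i. if i = n then 1 else 0 :: complex"
  have sums: "(\<lambda>i. ?e i * z ^ i) sums (z ^ n)" for z
    using sums_single[of n "\<lambda>i. z ^ i"] by (rule sums_cong[THEN iffD1, rotated]) simp
  then have "(\<lambda>x. of_real x ^ n) = (\<lambda>x. \<Sum>i. ?e i * of_real x ^ i)"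
    by (metis sums_unique)
  with smooth_power_series[of ?e] sums show ?thesis by (metis sums_summable)
qed

text \<open>Each \<open>diffs\<close> moves the coefficients down by one index, so k derivatives
  move the truncation point from N to N - k.\<close>

lemma diffs_funpow_truncate:
  fixes e :: "nat \<Rightarrow> complex"
  shows "(diffs ^^ k) (\<lambda>n. if n < N then 0 else e n) n = (if n + k < N then 0 else (diffs ^^ k) e n)"
  by (induction k arbitrary: n) (auto simp: diffs_def)

text \<open>The Taylor polynomials of an entire function converge to it in the topology of smooth functions.\<close>

lemma distribution_power_series:
  fixes e :: "nat \<Rightarrow> complex"
  assumes T: "T \<in> compact_distributions" and e: "\<And>z. summable (\<lambda>n. e n * z ^ n)"
  shows "(\<lambda>n. e n * T (\<lambda>x. of_real x ^ n)) sums T (\<lambda>x. \<Sum>n. e n * of_real x ^ n)"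
proof -
  obtain R m C where R: "R > 0" "C \<ge> 0" "seminorm_bounded T R m C"
    using compact_distribution_bounded[OF T] .
  have lin: "linear_functional T" by (rule compact_distributions_linear[OF T])
  let ?\<phi> = "\<lambda>x. \<Sum>n. e n * of_real x ^ n"
  have sm: "?\<phi> \<in> smooth_functions" by (rule smooth_power_series[OF e])
  define tr where "tr N n = (if n < N then 0 else e n)" for N n :: nat
  have sum_tr: "summable (\<lambda>n. tr N n * z ^ n)" for N z
  proof -
    have "\<forall>\<^sub>F n in sequentially. tr N n * z ^ n = e n * z ^ n"
      using eventually_ge_at_top[of N] by eventually_elim (simp add: tr_def)
    from summable_cong[OF this] e[of z] show ?thesis by simp
  qed
  define a where "a k n = norm ((diffs ^^ k) e n) * R ^ n" for k n
  have sum_a: "summable (a k)" for k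
  proof -
    have "summable (\<lambda>n. norm ((diffs ^^ k) e n * of_real R ^ n))"
    proof (rule powser_insidea)
      show "summable (\<lambda>n. (diffs ^^ k) e n * of_real (R + 1) ^ n)"
        by (rule summable_diffs_funpow[OF e])
      show "norm (complex_of_real R) < norm (complex_of_real (R + 1))" using R by simp
    qed
    then show ?thesis using R by (simp add: a_def[abs_def] norm_mult norm_power)
  qed
  \<comment> \<open>The start N - k is the one from \<open>diffs_funpow_truncate\<close>. For N < k
    it is 0 and the tail is the full series, which does not affect the limit.\<close>
  define tail where "tail k N = (\<Sum>n. a k (n + (N - k)))" for k N
  have tail_pos: "tail k N \<ge> 0" for k N
    unfolding tail_def using R by (intro suminf_nonneg summable_ignore_initial_segment sum_a) (auto simp: a_def)
  have tail_lim: "tail k \<longlonglongrightarrow> 0" for k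
  proof -
    have "(\<lambda>N. \<Sum>n. a k (n + N)) \<longlonglongrightarrow> 0" by (rule suminf_exist_split2[OF sum_a])
    moreover have "filterlim (\<lambda>N. N - k) sequentially sequentially"
      by (rule filterlim_minus_const_nat_at_top)
    ultimately show ?thesis unfolding tail_def by (rule filterlim_compose)
  qed
  have bd: "norm (T ?\<phi> - (\<Sum>n<N. e n * T (\<lambda>x. of_real x ^ n))) \<le> C * (\<Sum>k\<le>m. tail k N)" for N
  proof -
    have split: "?\<phi> x - (\<Sum>n<N. e n * of_real x ^ n) = (\<Sum>n. tr N n * of_real x ^ n)" for x
    proof -
      have "(\<Sum>n. tr N n * complex_of_real x ^ n) = (\<Sum>n. e n * of_real x ^ n - (if n < N then e n * of_real x ^ n else 0))"
        by (intro suminf_cong) (auto simp: tr_def)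
      also have "\<dots> = ?\<phi> x - (\<Sum>n. if n < N then e n * of_real x ^ n else 0)"
        using e by (intro suminf_diff[symmetric]) auto
      also have "(\<Sum>n. if n < N then e n * of_real x ^ n else 0) = (\<Sum>n<N. e n * of_real x ^ n)"
        using suminf_finite[of "{..<N}" "\<lambda>n. if n < N then e n * of_real x ^ n else 0"] by auto
      finally show ?thesis by simp
    qed
    have "T ?\<phi> - (\<Sum>n<N. e n * T (\<lambda>x. of_real x ^ n)) = T ?\<phi> - T (\<lambda>x. \<Sum>n<N. e n * of_real x ^ n)"
      by (simp add: linear_functional_sum[OF _ _ lin] smooth_scale smooth_monomial
           linear_functional_scale[OF lin])
    also have "\<dots> = T (\<lambda>x. ?\<phi> x - (\<Sum>n<N. e n * of_real x ^ n))"
      by (intro linear_functional_diff[symmetric] lin sm smooth_sum smooth_scale smooth_monomial) auto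
    also have "\<dots> = T (\<lambda>x. \<Sum>n. tr N n * of_real x ^ n)" unfolding split ..
    also have "norm \<dots> \<le> C * (\<Sum>k\<le>m. tail k N)"
    proof -
      have "norm (nth_deriv k (\<lambda>x. \<Sum>n. tr N n * of_real x ^ n) x) \<le> (\<Sum>k\<le>m. tail k N)"
        if k: "k \<le> m" and x: "x \<in> {-R..R}" for k x
      proof -
        let ?s = "\<lambda>n. (diffs ^^ k) (tr N) n * of_real x ^ n"
        have ab: "norm (?s n) \<le> (if n < N - k then 0 else a k n)" for n
          unfolding tr_def diffs_funpow_truncate using x
          by (auto simp: a_def norm_mult norm_power intro!: mult_left_mono power_mono)
        have sab: "summable (\<lambda>n. if n < N - k then 0 else a k n)"
          by (rule summable_comparison_test'[OF sum_a[of k], of 0]) (use R in \<open>auto simp: a_def\<close>)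
        have "norm (\<Sum>n. ?s n) \<le> (\<Sum>n. if n < N - k then 0 else a k n)"
          by (rule norm_suminf_le[OF ab sab])
        also have "\<dots> = tail k N"
          using suminf_split_initial_segment[OF sab, of "N - k"] by (simp add: tail_def)
        also have "\<dots> \<le> (\<Sum>k\<le>m. tail k N)"
          using k by (intro member_le_sum) (auto simp: tail_pos)
        finally show ?thesis by (simp add: nth_deriv_power_series[OF sum_tr])
      qed
      then show ?thesis using R(3) smooth_power_series[OF sum_tr] unfolding seminorm_bounded_def by blast
    qed
    finally show ?thesis .
  qed
  have "(\<lambda>N. C * (\<Sum>k\<le>m. tail k N)) \<longlonglongrightarrow> C * (\<Sum>k\<le>m. 0)"
    by (intro tendsto_intros tail_lim)
  then have "(\<lambda>N. T ?\<phi> - (\<Sum>n<N. e n * T (\<lambda>x. of_real x ^ n))) \<longlonglongrightarrow> 0"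
    using Lim_null_comparison[OF always_eventually[OF allI[OF bd]]] by simp
  then have "(\<lambda>N. T ?\<phi> - (T ?\<phi> - (\<Sum>n<N. e n * T (\<lambda>x. of_real x ^ n)))) \<longlonglongrightarrow> T ?\<phi> - 0"
    by (intro tendsto_intros)
  then show ?thesis by (simp add: sums_def)
qed

section \<open>The Bessel-Struve kernel\<close>

text \<open>The substitution u = t^2 in the Beta integral. The exponent \<open>s\<close> is real
  because it serves both the moments of the kernel (\<open>s\<close> = n) and those of the
  Erdelyi-Kober weight (\<open>s\<close> = 2 \<alpha> + 1 + n).\<close>

lemma powr_weight_integral:
  fixes s b :: real
  assumes "s > -1" "b > 0"
  shows "set_integrable lborel {0..1} (\<lambda>t. t powr s * (1 - t\<^sup>2) powr (b - 1))"
    and "(LBINT t:{0..1}. t powr s * (1 - t\<^sup>2) powr (b - 1)) = Beta ((s + 1) / 2) b / 2"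
proof -
  let ?f = "\<lambda>u. u powr ((s + 1) / 2 - 1) * (1 - u) powr (b - 1)"
  have int: "set_integrable lborel {0\<^sup>2..1\<^sup>2} ?f"
    using integrable_Beta[of "(s + 1) / 2" b] assms by simp
  have eq: "?f (t\<^sup>2) * (2 * t) = 2 * (t powr s * (1 - t\<^sup>2) powr (b - 1))" if "t \<in> {0..1}" for t
  \<comment> \<open>At t = 0 both sides are 0, because \<open>0 powr s\<close> is 0 for every
    \<open>s\<close>, even for \<open>s\<close> = 0.\<close>
  proof (cases "t = 0")
    case False
    with that have t: "t > 0" by auto
    have "(t\<^sup>2) powr ((s + 1) / 2 - 1) * t = t powr s"
    proof -
      have "(t\<^sup>2) powr ((s + 1) / 2 - 1) = t powr (s - 1)"
      proof -
        have "(t powr 2) powr ((s + 1) / 2 - 1) = t powr (2 * ((s + 1) / 2 - 1))"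
          by (rule powr_powr)
        also have "2 * ((s + 1) / 2 - 1) = s - 1" by simp
        finally show ?thesis using t by simp
      qed
      then show ?thesis using t by (simp add: powr_diff)
    qed
    then show ?thesis by (simp add: algebra_simps)
  qed simp
  have d: "((\<lambda>t. t\<^sup>2) has_real_derivative 2 * t) (at t)" for t :: real
    by (auto intro!: derivative_eq_intros)
  have "set_integrable lborel {0..1} (\<lambda>t. ?f (t\<^sup>2) * (2 * t))"
    by (rule integral_substitution(1)[OF int d]) (auto intro!: continuous_intros)
  then have "set_integrable lborel {0..1} (\<lambda>t. 2 * (t powr s * (1 - t\<^sup>2) powr (b - 1)))"
    by (subst (asm) set_integrable_cong[OF refl refl eq]) auto
  then show "set_integrable lborel {0..1} (\<lambda>t. t powr s * (1 - t\<^sup>2) powr (b - 1))"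
    by simp
  have "Beta ((s + 1) / 2) b = integral {0..1} ?f"
    using has_integral_Beta_real[of "(s + 1) / 2" b] assms by (simp add: has_integral_iff)
  also have "\<dots> = (LBINT u:{0..1}. ?f u)"
    using set_borel_integral_eq_integral(2)[of "{0..1}" ?f] int by simp
  also have "\<dots> = (LBINT u. ?f u * indicator {0\<^sup>2..1\<^sup>2} u)"
    by (simp add: set_lebesgue_integral_def mult.commute)
  also have "\<dots> = (LBINT t. ?f (t\<^sup>2) * (2 * t) * indicator {0..1} t)"
    by (rule integral_substitution(2)[OF int d]) (auto intro!: continuous_intros)
  also have "\<dots> = (LBINT t:{0..1}. ?f (t\<^sup>2) * (2 * t))"
    by (simp add: set_lebesgue_integral_def mult.commute)
  also have "\<dots> = (LBINT t:{0..1}. 2 * (t powr s * (1 - t\<^sup>2) powr (b - 1)))"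
    by (rule set_lebesgue_integral_cong) (use eq in auto)
  finally show "(LBINT t:{0..1}. t powr s * (1 - t\<^sup>2) powr (b - 1)) = Beta ((s + 1) / 2) b / 2"
    by simp
qed

definition bs_moment :: "real \<Rightarrow> nat \<Rightarrow> real" where
  "bs_moment \<alpha> n = (LBINT t:{0..1}. (1 - t\<^sup>2) powr (\<alpha> - 1/2) * t ^ n)"

lemma bs_moment_integral:
  assumes "\<alpha> > -1/2"
  shows bs_moment_integrable: "set_integrable lborel {0..1} (\<lambda>t. (1 - t\<^sup>2) powr (\<alpha> - 1/2) * t ^ n)"
    and bs_moment_Beta: "bs_moment \<alpha> n = Beta ((real n + 1) / 2) (\<alpha> + 1/2) / 2"
proof -
  let ?f = "\<lambda>t. t powr real n * (1 - t\<^sup>2) powr (\<alpha> + 1/2 - 1)"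
  let ?g = "\<lambda>t. (1 - t\<^sup>2) powr (\<alpha> - 1/2) * t ^ n"
  note w = powr_weight_integral[of "real n" "\<alpha> + 1/2"]
  have meas: "(\<lambda>t. indicator {0..1} t *\<^sub>R ?g t) \<in> borel_measurable lborel"
    "(\<lambda>t. indicator {0..1} t *\<^sub>R ?f t) \<in> borel_measurable lborel"
    by measurable
  \<comment> \<open>The exceptional point t = 0 matters for n = 0, where \<open>0 powr 0\<close> is
    0 and \<open>0 ^ 0\<close> is 1.\<close>
  have ae: "AE t in lborel. indicator {0..1} t *\<^sub>R ?g t = indicator {0..1::real} t *\<^sub>R ?f t"
    using AE_lborel_singleton[of 0]
    by eventually_elim (auto simp: indicator_def powr_realpow mult.commute)
  show "set_integrable lborel {0..1} ?g"
    using integrable_cong_AE[OF meas ae] w assms by (simp add: set_integrable_def)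
  show "bs_moment \<alpha> n = Beta ((real n + 1) / 2) (\<alpha> + 1/2) / 2"
    unfolding bs_moment_def set_lebesgue_integral_def
    using integral_cong_AE[OF meas ae] w assms by (simp add: set_lebesgue_integral_def)
qed

lemma bs_moment_nonneg: "bs_moment \<alpha> n \<ge> 0"
  unfolding bs_moment_def set_lebesgue_integral_def
  by (rule integral_nonneg_AE) (auto simp: indicator_def)

lemma bs_moment_le:
  assumes "\<alpha> > -1/2"
  shows "bs_moment \<alpha> n \<le> bs_moment \<alpha> 0"
  unfolding bs_moment_def
  by (rule set_integral_mono)
     (use bs_moment_integrable[OF assms, of n] bs_moment_integrable[OF assms, of 0]
      in \<open>auto intro!: mult_left_le power_le_one\<close>)

definition bs_const :: "real \<Rightarrow> real" where
  "bs_const \<alpha> = 2 * Gamma (\<alpha> + 1) / (sqrt pi * Gamma (\<alpha> + 1/2))"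

text \<open>By \<open>bs_fun_deriv\<close> this is the k-th derivative of the kernel as a function
  of w = l x. The integral form yields one growth bound for all k, as t^k \<le> 1 on [0, 1].\<close>

definition bs_fun :: "real \<Rightarrow> nat \<Rightarrow> complex \<Rightarrow> complex" where
  "bs_fun \<alpha> k w = of_real (bs_const \<alpha>) *
     (LBINT t:{0..1}. of_real ((1 - t\<^sup>2) powr (\<alpha> - 1/2) * t ^ k) * exp (w * of_real t))"

lemma bessel_struve_kernel_eq: "bessel_struve_kernel \<alpha> l x = bs_fun \<alpha> 0 (l * of_real x)"
  by (simp add: bessel_struve_kernel_def bs_fun_def bs_const_def)

text \<open>Expand the exponential and integrate term by term. No moment exceeds
  \<open>bs_moment \<alpha> 0\<close>, so the series of integrated norms is dominated by this
  constant times the series of exp |w|.\<close>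

lemma bs_fun_sums:
  assumes "\<alpha> > -1/2"
  shows "(\<lambda>n. of_real (bs_const \<alpha> * bs_moment \<alpha> (n + k) / fact n) * w ^ n) sums bs_fun \<alpha> k w"
    and "norm (bs_fun \<alpha> k w) \<le> \<bar>bs_const \<alpha>\<bar> * bs_moment \<alpha> 0 * exp \<bar>Re w\<bar>"
proof -
  let ?W = "\<lambda>k t. (1 - t\<^sup>2) powr (\<alpha> - 1/2) * t ^ k"
  define f where "f n t = complex_of_real (indicator {0..1} t *\<^sub>R ?W (n + k) t) * (w ^ n /\<^sub>R fact n)" for n t
  have int: "integrable lborel (f n)" for n
    unfolding f_def using bs_moment_integrable[OF assms, of "n + k"]
    by (intro integrable_mult_left integrable_of_real) (simp add: set_integrable_def)
  have If: "integral\<^sup>L lborel (f n) = of_real (bs_moment \<alpha> (n + k)) * (w ^ n /\<^sub>R fact n)" for n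
    unfolding f_def bs_moment_def set_lebesgue_integral_def
    by (simp only: integral_mult_left_zero integral_complex_of_real)
  have nf: "norm (f n t) = indicator {0..1} t *\<^sub>R ?W (n + k) t * (norm w ^ n / fact n)" for n t
    by (auto simp: f_def norm_mult norm_power norm_divide indicator_def field_simps)
  have Inf: "(LBINT t. norm (f n t)) = bs_moment \<alpha> (n + k) * (norm w ^ n / fact n)" for n
    unfolding nf bs_moment_def set_lebesgue_integral_def by simp
  have exps: "(\<lambda>n. f n t) sums (indicator {0..1} t *\<^sub>R (complex_of_real (?W k t) * exp (w * of_real t)))" for t
  proof -
    have "(\<lambda>n. (indicator {0..1} t *\<^sub>R complex_of_real (?W k t)) * ((w * of_real t) ^ n /\<^sub>R fact n)) sums
      ((indicator {0..1} t *\<^sub>R complex_of_real (?W k t)) * exp (w * of_real t))"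
      by (intro sums_mult exp_converges)
    also have "(\<lambda>n. (indicator {0..1} t *\<^sub>R complex_of_real (?W k t)) * ((w * of_real t) ^ n /\<^sub>R fact n)) = (\<lambda>n. f n t)"
      by (auto simp: f_def power_mult_distrib power_add mult_ac scaleR_conv_of_real)
    finally show ?thesis by simp
  qed
  have sumI: "summable (\<lambda>n. LBINT t. norm (f n t))"
  proof (rule summable_comparison_test'[of _ 0])
    show "summable (\<lambda>n. bs_moment \<alpha> 0 * (norm w ^ n / fact n))"
      using summable_exp[of "norm w"] by (intro summable_mult) (simp add: field_simps)
    show "norm (LBINT t. norm (f n t)) \<le> bs_moment \<alpha> 0 * (norm w ^ n / fact n)" for n
      unfolding Inf using bs_moment_le[OF assms] bs_moment_nonneg
      by (auto intro!: mult_right_mono divide_right_mono)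
  qed
  have summ: "AE t in lborel. summable (\<lambda>n. norm (f n t))"
  proof (rule AE_I2)
    fix t :: real
    have "summable (\<lambda>n. (indicator {0..1} t *\<^sub>R ?W k t) * ((norm w * \<bar>t\<bar>) ^ n / fact n))"
      using summable_exp[of "norm w * \<bar>t\<bar>"] by (intro summable_mult) (simp add: field_simps)
    also have "(\<lambda>n. (indicator {0..1} t *\<^sub>R ?W k t) * ((norm w * \<bar>t\<bar>) ^ n / fact n)) = (\<lambda>n. norm (f n t))"
      unfolding nf by (auto simp: indicator_def power_add power_mult_distrib)
    finally show "summable (\<lambda>n. norm (f n t))" .
  qed
  have suminf_f: "(\<Sum>n. f n t) = indicator {0..1} t *\<^sub>R (complex_of_real (?W k t) * exp (w * of_real t))" for t
    using sums_unique[OF exps] by simp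
  have "(\<lambda>n. integral\<^sup>L lborel (f n)) sums (LBINT t. \<Sum>n. f n t)"
    by (rule sums_integral[OF int summ sumI])
  from sums_mult[OF this, of "of_real (bs_const \<alpha>)"]
  show "(\<lambda>n. of_real (bs_const \<alpha> * bs_moment \<alpha> (n + k) / fact n) * w ^ n) sums bs_fun \<alpha> k w"
    unfolding If suminf_f bs_fun_def set_lebesgue_integral_def
    by (simp add: scaleR_conv_of_real field_simps)
  have "integrable lborel (\<lambda>t. \<Sum>n. f n t)"
    by (rule integrable_suminf[OF int summ sumI])
  then have i1: "integrable lborel (\<lambda>t. norm (indicator {0..1} t *\<^sub>R (complex_of_real (?W k t) * exp (w * of_real t))))"
    unfolding suminf_f by (rule integrable_norm)
  have "norm (LBINT t. indicator {0..1} t *\<^sub>R (complex_of_real (?W k t) * exp (w * of_real t))) \<le>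
     (LBINT t. norm (indicator {0..1} t *\<^sub>R (complex_of_real (?W k t) * exp (w * of_real t))))"
    by (rule integral_norm_bound)
  also have "\<dots> \<le> (LBINT t. (indicator {0..1} t *\<^sub>R ?W 0 t) * exp \<bar>Re w\<bar>)"
  proof (rule integral_mono[OF i1])
    show "integrable lborel (\<lambda>t. (indicator {0..1} t *\<^sub>R ?W 0 t) * exp \<bar>Re w\<bar>)"
      using bs_moment_integrable[OF assms, of 0]
      by (intro integrable_mult_left) (simp add: set_integrable_def)
    fix t :: real
    show "norm (indicator {0..1} t *\<^sub>R (complex_of_real (?W k t) * exp (w * of_real t)))
         \<le> (indicator {0..1} t *\<^sub>R ?W 0 t) * exp \<bar>Re w\<bar>"
    proof (cases "t \<in> {0..1}")
      case True
      have "Re w * t \<le> \<bar>Re w\<bar> * 1" using True by (intro mult_mono) auto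
      moreover have "t ^ k \<le> 1" using True by (simp add: power_le_one)
      ultimately have "t ^ k * exp (Re w * t) \<le> 1 * exp \<bar>Re w\<bar>"
        using True by (intro mult_mono) auto
      then show ?thesis using True
        by (simp add: norm_mult norm_power mult.assoc mult_left_mono)
    qed simp
  qed
  also have "\<dots> = bs_moment \<alpha> 0 * exp \<bar>Re w\<bar>"
    by (simp add: bs_moment_def set_lebesgue_integral_def)
  finally show "norm (bs_fun \<alpha> k w) \<le> \<bar>bs_const \<alpha>\<bar> * bs_moment \<alpha> 0 * exp \<bar>Re w\<bar>"
    unfolding bs_fun_def set_lebesgue_integral_def norm_mult
    by (simp add: mult.assoc mult_left_mono)
qed

text \<open>Differentiating the series replaces differentiation under the integral: the factor n + 1
  from \<open>diffs\<close> cancels against the factorial, and what remains are the moments with k +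
  1 in place of k.\<close>

lemma bs_fun_deriv:
  assumes "\<alpha> > -1/2"
  shows "(bs_fun \<alpha> k has_field_derivative bs_fun \<alpha> (Suc k) w) (at w)"
proof -
  let ?c = "\<lambda>n. complex_of_real (bs_const \<alpha> * bs_moment \<alpha> (n + k) / fact n)"
  have eq: "bs_fun \<alpha> k = (\<lambda>w. \<Sum>n. ?c n * w ^ n)"
    using sums_unique[OF bs_fun_sums(1)[OF assms]] by auto
  have "diffs ?c = (\<lambda>n. of_real (bs_const \<alpha> * bs_moment \<alpha> (n + Suc k) / fact n))"
  proof
    fix n
    have "of_nat (Suc n) * (X / fact (Suc n)) = (X / fact n :: complex)" for X
      by (simp del: of_nat_Suc)
    then show "diffs ?c n = of_real (bs_const \<alpha> * bs_moment \<alpha> (n + Suc k) / fact n)"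
      by (simp add: diffs_def del: of_nat_Suc fact_Suc)
  qed
  then have eq': "(\<Sum>n. diffs ?c n * w ^ n) = bs_fun \<alpha> (Suc k) w"
    using sums_unique[OF bs_fun_sums(1)[OF assms, of "Suc k" w]] by simp
  have "((\<lambda>w. \<Sum>n. ?c n * w ^ n) has_field_derivative (\<Sum>n. diffs ?c n * w ^ n)) (at w)"
    by (rule termdiffs_strong_converges_everywhere)
       (use bs_fun_sums(1)[OF assms] in \<open>auto dest: sums_summable\<close>)
  then show ?thesis unfolding eq' eq[symmetric] .
qed

lemma
  assumes "\<alpha> > -1/2"
  shows nth_deriv_kernel:
      "nth_deriv k (bessel_struve_kernel \<alpha> l) = (\<lambda>x. l ^ k * bs_fun \<alpha> k (l * of_real x))"
    and smooth_kernel: "bessel_struve_kernel \<alpha> l \<in> smooth_functions"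
proof -
  let ?d = "\<lambda>k x. l ^ k * bs_fun \<alpha> k (l * complex_of_real x)"
  have d: "(?d k has_vector_derivative ?d (Suc k) x) (at x)" for k x
  proof -
    have "((\<lambda>z. l ^ k * bs_fun \<alpha> k (l * z)) has_field_derivative
        l ^ k * (bs_fun \<alpha> (Suc k) (l * of_real x) * l)) (at (of_real x))"
      by (auto intro!: derivative_eq_intros DERIV_chain'[OF _ bs_fun_deriv[OF assms]])
    from has_vector_derivative_real_field[OF this] show ?thesis by (simp add: mult_ac)
  qed
  show "nth_deriv k (bessel_struve_kernel \<alpha> l) = ?d k"
    by (rule nth_deriv_eqI[where d = ?d]) (use d in \<open>auto simp: bessel_struve_kernel_eq\<close>)
  show "bessel_struve_kernel \<alpha> l \<in> smooth_functions"
    by (rule smoothI[where d = ?d]) (use d in \<open>auto simp: bessel_struve_kernel_eq\<close>)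
qed

text \<open>Hence the transform is determined by the moments of \<open>T\<close>, and finding
  \<open>T\<close> for a given transform becomes a matter of matching Taylor coefficients.\<close>

lemma distribution_kernel_sums:
  assumes "\<alpha> > -1/2" "T \<in> compact_distributions"
  shows "(\<lambda>n. of_real (bs_const \<alpha> * bs_moment \<alpha> n / fact n) * T (\<lambda>x. of_real x ^ n) * l ^ n) sums
           T (bessel_struve_kernel \<alpha> l)"
proof -
  let ?e = "\<lambda>n. of_real (bs_const \<alpha> * bs_moment \<alpha> n / fact n) * l ^ n"
  have s: "(\<lambda>n. ?e n * z ^ n) sums bs_fun \<alpha> 0 (l * z)" for z
    using bs_fun_sums(1)[OF assms(1), of 0 "l * z"] by (simp add: power_mult_distrib mult_ac)
  have "(\<lambda>n. ?e n * T (\<lambda>x. of_real x ^ n)) sums T (\<lambda>x. \<Sum>n. ?e n * of_real x ^ n)"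
    by (rule distribution_power_series[OF assms(2)]) (use s in \<open>auto dest: sums_summable\<close>)
  moreover have "(\<lambda>x. \<Sum>n. ?e n * of_real x ^ n) = bessel_struve_kernel \<alpha> l"
    using sums_unique[OF s] by (auto simp: bessel_struve_kernel_eq)
  ultimately show ?thesis by (simp add: mult_ac)
qed

section \<open>Smooth cutoff functions\<close>

definition flat :: "real poly \<Rightarrow> real \<Rightarrow> real" where
  "flat p x = (if x > 0 then poly p (1 / x) * exp (- (1 / x)) else 0)"

text \<open>With y = 1/x one has dy/dx = - y^2, so p(y) exp(-y) has the derivative y^2 (p(y) -
  p'(y)) exp(-y) in x.\<close>

definition flat_step :: "real poly \<Rightarrow> real poly" where
  "flat_step p = [:0, 0, 1:] * (p - pderiv p)"

lemma poly_exp_minus_tendsto_0: "((\<lambda>y. poly p y * exp (- y)) \<longlongrightarrow> 0) at_top" for p :: "real poly"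
proof -
  have "((\<lambda>y. \<Sum>i\<le>degree p. coeff p i * (y ^ i / exp y)) \<longlongrightarrow> (\<Sum>i\<le>degree p. coeff p i * 0)) at_top"
    by (intro tendsto_intros tendsto_power_div_exp_0)
  then show ?thesis
    by (simp add: poly_altdef sum_distrib_right exp_minus divide_inverse mult.assoc)
qed

lemma flat_deriv: "(flat p has_real_derivative flat (flat_step p) x) (at x)"
proof -
  consider "x > 0" | "x < 0" | "x = 0" by linarith
  then show ?thesis
  proof cases
    case 1
    have "((\<lambda>x. poly p (1 / x) * exp (- (1 / x))) has_real_derivative
      poly p (1 / x) * (exp (- (1 / x)) * (1 / x\<^sup>2)) + poly (pderiv p) (1 / x) * (- 1 / x\<^sup>2) * exp (- (1 / x))) (at x)"
      using 1 by (auto intro!: derivative_eq_intros DERIV_chain'[OF _ poly_DERIV] simp: power2_eq_square field_simps)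
    also have "poly p (1 / x) * (exp (- (1 / x)) * (1 / x\<^sup>2)) + poly (pderiv p) (1 / x) * (- 1 / x\<^sup>2) * exp (- (1 / x))
      = flat (flat_step p) x"
      using 1 by (simp add: flat_def flat_step_def power2_eq_square field_simps)
    finally show ?thesis
      by (rule has_field_derivative_transform_within_open[where S = "{0<..}"]) (use 1 in \<open>auto simp: flat_def\<close>)
  next
    case 2
    have "((\<lambda>x. 0) has_real_derivative 0) (at x)" by simp
    from has_field_derivative_transform_within_open[OF this, of "{..<0}" "flat p"] show ?thesis
      using 2 by (auto simp: flat_def)
  next
    case 3
    have "((\<lambda>h. flat p h / h) \<longlongrightarrow> 0) (at_right 0)"
    proof -
      \<comment> \<open>With y = 1/h the difference quotient at 0 is y p(y) exp(-y), again a
        polynomial times exp(-y).\<close>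
      have "((\<lambda>h. poly ([:0, 1:] * p) (1 / h) * exp (- (1 / h))) \<longlongrightarrow> 0) (at_right 0)"
        using filterlim_compose[OF poly_exp_minus_tendsto_0[of "[:0, 1:] * p"] filterlim_inverse_at_top_right]
        by (simp add: divide_inverse)
      then show ?thesis
        by (rule Lim_transform_eventually)
           (use eventually_at_right_less[of 0] in \<open>eventually_elim, simp add: flat_def field_simps\<close>)
    qed
    moreover have "((\<lambda>h. flat p h / h) \<longlongrightarrow> 0) (at_left 0)"
      by (rule Lim_transform_eventually[OF tendsto_const])
         (use eventually_at_left_real[of "-1" 0] in \<open>auto elim!: eventually_mono simp: flat_def\<close>)
    ultimately have "((\<lambda>h. flat p h / h) \<longlongrightarrow> 0) (at 0)"
      by (simp add: filterlim_at_split)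
    then show ?thesis using 3 by (simp add: DERIV_def flat_def)
  qed
qed

lemma smooth_flat: "(\<lambda>x. of_real (flat p x)) \<in> smooth_functions"
proof (rule smoothI[where d = "\<lambda>k x. of_real (flat ((flat_step ^^ k) p) x)"])
  fix k x
  have "(flat ((flat_step ^^ k) p) has_real_derivative flat ((flat_step ^^ Suc k) p) x) (at x)"
    using flat_deriv[of "(flat_step ^^ k) p" x] by simp
  then show "((\<lambda>x. complex_of_real (flat ((flat_step ^^ k) p) x)) has_vector_derivative
      complex_of_real (flat ((flat_step ^^ Suc k) p) x)) (at x)"
    by (rule has_vector_derivative_of_real)
qed simp

definition smooth_bump :: "real \<Rightarrow> real" where
  "smooth_bump x = flat 1 x * flat 1 (1 - x)"

text \<open>It rises from 0 to 1 on [0, 1]. For x < 0 the interval of integration is empty, which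
  gives the value 0 without a case distinction.\<close>

definition smooth_step :: "real \<Rightarrow> real" where
  "smooth_step x = integral {0..x} smooth_bump / integral {0..1} smooth_bump"

lemma smooth_bump_smooth: "(\<lambda>x. of_real (smooth_bump x)) \<in> smooth_functions"
  using smooth_mult[OF smooth_flat[of 1] smooth_affine[OF smooth_flat[of 1], of "-1" 1]]
  by (simp add: smooth_bump_def)

lemma smooth_bump_continuous: "continuous_on S smooth_bump"
proof -
  have "continuous_on S (\<lambda>x. Re (of_real (smooth_bump x)))"
    by (intro continuous_on_Re smooth_continuous smooth_bump_smooth)
  then show ?thesis by simp
qed

lemma smooth_bump_pos: "0 < x \<Longrightarrow> x < 1 \<Longrightarrow> smooth_bump x > 0"
  and smooth_bump_nonneg: "smooth_bump x \<ge> 0"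
  and smooth_bump_zero: "x \<le> 0 \<or> x \<ge> 1 \<Longrightarrow> smooth_bump x = 0"
  by (auto simp: smooth_bump_def flat_def)

lemma smooth_bump_integral_pos: "integral {0..1} smooth_bump \<noteq> 0"
proof
  assume "integral {0..1} smooth_bump = 0"
  then have "\<forall>x\<in>{0..1}. smooth_bump x = 0"
    using integral_eq_0_iff[of 0 1 smooth_bump] smooth_bump_continuous smooth_bump_nonneg by auto
  then have "smooth_bump (1/2) = 0" by simp
  then show False using smooth_bump_pos[of "1/2"] by simp
qed

lemma smooth_step_0: "x \<le> 0 \<Longrightarrow> smooth_step x = 0"
  by (cases "x = 0") (auto simp: smooth_step_def)

lemma smooth_step_1:
  assumes "x \<ge> 1"
  shows "smooth_step x = 1"
proof -
  have "integral {0..1} smooth_bump + integral {1..x} smooth_bump = integral {0..x} smooth_bump"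
    by (rule Henstock_Kurzweil_Integration.integral_combine)
       (use assms in \<open>auto intro!: integrable_continuous_real smooth_bump_continuous\<close>)
  moreover have "integral {1..x} smooth_bump = integral {1..x} (\<lambda>x. 0)"
    by (rule Henstock_Kurzweil_Integration.integral_cong) (auto simp: smooth_bump_zero)
  ultimately show ?thesis using smooth_bump_integral_pos by (simp add: smooth_step_def)
qed

lemma smooth_step_deriv:
  "(smooth_step has_real_derivative smooth_bump x / integral {0..1} smooth_bump) (at x)"
proof (cases "x < 0")
  case True
  have "((\<lambda>x. 0) has_real_derivative 0) (at x)" by simp
  from has_field_derivative_transform_within_open[OF this, of "{..<0}" smooth_step] show ?thesis
    using True by (auto simp: smooth_step_0 smooth_bump_zero)
next
  case False
  \<comment> \<open>Integrating from 0 would give only a one-sided derivative at x = 0. Starting at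
    -1 makes every x \<ge> 0 interior and leaves the value unchanged, the bump being 0 on
    [-1, 0].\<close>
  have "((\<lambda>y. integral {-1..y} smooth_bump) has_real_derivative smooth_bump x) (at x within {-1..x+1})"
    using False by (intro integral_has_real_derivative smooth_bump_continuous) auto
  then have "((\<lambda>y. integral {-1..y} smooth_bump) has_real_derivative smooth_bump x) (at x within {-1<..<x+1})"
    by (rule DERIV_subset) auto
  then have "((\<lambda>y. integral {-1..y} smooth_bump) has_real_derivative smooth_bump x) (at x)"
    using False by (subst (asm) at_within_open) auto
  then have "((\<lambda>y. integral {-1..y} smooth_bump / integral {0..1} smooth_bump) has_real_derivative
     smooth_bump x / integral {0..1} smooth_bump) (at x)"
    by (rule DERIV_cdivide)
  then show ?thesis
  proof (rule has_field_derivative_transform_within_open[where S = "{-1<..}"])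
    fix y :: real assume y: "y \<in> {-1<..}"
    have z: "integral {-1..c} smooth_bump = 0" if "c \<le> 0" for c
    proof -
      have "integral {-1..c} smooth_bump = integral {-1..c} (\<lambda>x. 0)"
        by (rule Henstock_Kurzweil_Integration.integral_cong) (use that in \<open>auto simp: smooth_bump_zero\<close>)
      then show ?thesis by simp
    qed
    have "integral {-1..y} smooth_bump = integral {0..y} smooth_bump"
    proof (cases "y \<le> 0")
      case True
      then show ?thesis using z by (cases "y = 0") auto
    next
      case False
      have "integral {-1..0} smooth_bump + integral {0..y} smooth_bump = integral {-1..y} smooth_bump"
        by (rule Henstock_Kurzweil_Integration.integral_combine)
           (use False in \<open>auto intro!: integrable_continuous_real smooth_bump_continuous\<close>)
      then show ?thesis using z[of 0] by simp
    qed
    then show "integral {-1..y} smooth_bump / integral {0..1} smooth_bump = smooth_step y"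
      by (simp add: smooth_step_def)
  qed (use False in auto)
qed

abbreviation step :: "real \<Rightarrow> complex" where "step x \<equiv> of_real (smooth_step x)"

lemma smooth_step_smooth: "step \<in> smooth_functions"
proof -
  let ?b = "\<lambda>x. of_real (1 / integral {0..1} smooth_bump) * complex_of_real (smooth_bump x)"
  have b: "?b \<in> smooth_functions" by (rule smooth_scale[OF smooth_bump_smooth])
  show ?thesis
  proof (rule smoothI[where d = "\<lambda>k. case k of 0 \<Rightarrow> step | Suc j \<Rightarrow> nth_deriv j ?b"])
    fix k x
    show "((case k of 0 \<Rightarrow> step | Suc j \<Rightarrow> nth_deriv j ?b) has_vector_derivative
      (case Suc k of 0 \<Rightarrow> step | Suc j \<Rightarrow> nth_deriv j ?b) x) (at x)"
    proof (cases k)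
      case 0
      have "(step has_vector_derivative complex_of_real (smooth_bump x / integral {0..1} smooth_bump)) (at x)"
        by (rule has_vector_derivative_of_real[OF smooth_step_deriv])
      then show ?thesis by (simp add: 0)
    next
      case (Suc j)
      then show ?thesis using smooth_deriv[OF b] by simp
    qed
  qed simp
qed

lemma step_deriv_bounded:
  obtains A where "A \<ge> 0" "\<And>k x. k \<le> m \<Longrightarrow> norm (nth_deriv k step x) \<le> A"
proof -
  have "\<exists>A\<ge>0. \<forall>x. norm (nth_deriv k step x) \<le> A" for k
  proof -
    have "compact ((\<lambda>x. nth_deriv k step x) ` {-1..2})"
      by (intro compact_continuous_image smooth_nth_deriv_continuous smooth_step_smooth) auto
    from compact_imp_bounded[OF this] obtain A where A: "A > 0"
        "\<And>x. -1 \<le> x \<and> x \<le> 2 \<Longrightarrow> norm (nth_deriv k step x) \<le> A"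
      unfolding bounded_pos by auto
    \<comment> \<open>The summand 1 covers k = 0 to the right of the window, where the value is
      1.\<close>
    have "norm (nth_deriv k step x) \<le> A + 1" for x
    proof -
      consider "-1 \<le> x \<and> x \<le> 2" | "x < -1" | "x > 2" by linarith
      then show ?thesis
      proof cases
        case 1
        then show ?thesis using A(2)[of x] by simp
      next
        case 2
        have "nth_deriv k step x = nth_deriv k (\<lambda>x. 0) x"
          by (rule nth_deriv_cong_open[of "{..<0}"]) (use 2 in \<open>auto simp: smooth_step_0\<close>)
        then show ?thesis using A(1) by (simp add: nth_deriv_const)
      next
        case 3
        have "nth_deriv k step x = nth_deriv k (\<lambda>x. 1) x"
          by (rule nth_deriv_cong_open[of "{1<..}"]) (use 3 in \<open>auto simp: smooth_step_1\<close>)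
        then show ?thesis using A(1) by (simp add: nth_deriv_const)
      qed
    qed
    then show ?thesis using A(1) by (intro exI[of _ "A + 1"]) auto
  qed
  then obtain A where A: "\<And>k. A k \<ge> 0" "\<And>k x. norm (nth_deriv k step x) \<le> A k" by metis
  show ?thesis
  proof (rule that[of "\<Sum>k\<le>m. A k"])
    show "(\<Sum>k\<le>m. A k) \<ge> 0" by (intro sum_nonneg A)
    fix k x assume "k \<le> m"
    then have "A k \<le> (\<Sum>k\<le>m. A k)" by (intro member_le_sum) (auto simp: A)
    then show "norm (nth_deriv k step x) \<le> (\<Sum>k\<le>m. A k)" using A(2)[of k x] by simp
  qed
qed

text \<open>The transition takes place where c + d \<le> |x| \<le> c + 2 d. The plateau exceeds
  [-c, c] by d because a distribution supported there is known to ignore only functions that vanish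
  on a neighbourhood of [-c, c].\<close>

definition cutoff :: "real \<Rightarrow> real \<Rightarrow> real \<Rightarrow> complex" where
  "cutoff c d x = step ((x + c) / d + 2) * step ((c - x) / d + 2)"

lemma step_affine_form:
  "step ((x + c) / d + 2) = step ((1 / d) * x + (c / d + 2))"
  "step ((c - x) / d + 2) = step ((- 1 / d) * x + (c / d + 2))"
  by (simp_all add: add_divide_distrib diff_divide_distrib algebra_simps)

lemma cutoff_smooth: "cutoff c d \<in> smooth_functions"
  unfolding cutoff_def step_affine_form
  by (intro smooth_mult smooth_affine smooth_step_smooth)

lemma cutoff_1: "d > 0 \<Longrightarrow> \<bar>x\<bar> \<le> c + d \<Longrightarrow> cutoff c d x = 1"
  by (simp add: cutoff_def smooth_step_1 field_simps abs_le_iff)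

lemma cutoff_0: "d > 0 \<Longrightarrow> \<bar>x\<bar> \<ge> c + 2 * d \<Longrightarrow> cutoff c d x = 0"
  by (auto simp: cutoff_def smooth_step_0 field_simps abs_if split: if_splits)

text \<open>\<open>A\<close> belongs to the fixed step function, so the dependence on the width is
  explicit: a factor 2 / d per derivative.\<close>

lemma cutoff_deriv_bound:
  assumes A: "A \<ge> 0" "\<And>k x. k \<le> m \<Longrightarrow> norm (nth_deriv k step x) \<le> A" and "d > 0" "k \<le> m"
  shows "norm (nth_deriv k (cutoff c d) x) \<le> A * A * (2 * (1 / d)) ^ k"
  unfolding cutoff_def step_affine_form
proof (rule nth_deriv_mult_bound)
  show "norm (nth_deriv j (\<lambda>x. step (1 / d * x + (c / d + 2))) x) \<le> A * (1 / d) ^ j" if "j \<le> k" for j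
    using A(2)[of j] that assms unfolding nth_deriv_affine[OF smooth_step_smooth, of j "1 / d"]
    by (auto simp: norm_mult norm_power norm_divide divide_right_mono)
  show "norm (nth_deriv j (\<lambda>x. step (- 1 / d * x + (c / d + 2))) x) \<le> A * (1 / d) ^ j" if "j \<le> k" for j
    using A(2)[of j] that assms unfolding nth_deriv_affine[OF smooth_step_smooth, of j "- 1 / d"]
    by (auto simp: norm_mult norm_power norm_divide divide_right_mono)
  show "(\<lambda>x. step (1 / d * x + (c / d + 2))) \<in> smooth_functions"
    "(\<lambda>x. step (- 1 / d * x + (c / d + 2))) \<in> smooth_functions"
    by (rule smooth_affine[OF smooth_step_smooth])+
qed (use assms in auto)

section \<open>Growth of the transform\<close>

text \<open>Splitting \<open>f\<close> with the telescoping partition of unity given by translates of the smooth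
  step reduces the claim to pieces whose support lies in a single open set on which \<open>T\<close> vanishes.\<close>

lemma distribution_vanishes_test:
  assumes T: "T \<in> compact_distributions" and supp: "distribution_support T \<subseteq> {-b..b}"
    and f: "f \<in> smooth_functions" and "b' > b"
    and in0: "\<And>x. \<bar>x\<bar> < b' \<Longrightarrow> f x = 0" and out0: "\<And>x. \<bar>x\<bar> > M \<Longrightarrow> f x = 0"
  shows "T f = 0"
proof -
  have lin: "linear_functional T" by (rule compact_distributions_linear[OF T])
  define K where "K = {x::real. b' \<le> \<bar>x\<bar>} \<inter> {-M..M}"
  have "closed {x::real. b' \<le> \<bar>x\<bar>}" by (intro closed_Collect_le continuous_intros)
  then have K: "compact K" unfolding K_def by (simp add: closed_Int_compact)
  have suppK: "x \<in> K" if "f x \<noteq> 0" for x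
  proof -
    have "\<not> \<bar>x\<bar> < b'" "\<not> \<bar>x\<bar> > M" using that in0 out0 by blast+
    then show ?thesis by (simp add: K_def) linarith
  qed
  define G where "G = {U. open U \<and> (\<forall>f\<in>test_functions U. T f = 0)}"
  have "K \<subseteq> - {-b..b}" using \<open>b' > b\<close> by (auto simp: K_def)
  then have KG: "K \<subseteq> \<Union>G" using supp unfolding distribution_support_def G_def by blast
  have "open U" if "U \<in> G" for U using that by (simp add: G_def)
  \<comment> \<open>\<open>e\<close> is a Lebesgue number of the cover.\<close>
  then obtain e where e: "e > 0" "\<And>x. x \<in> K \<Longrightarrow> \<exists>U\<in>G. ball x e \<subseteq> U"
    using Heine_Borel_lemma[OF K KG] by metis
  define d where "d = e / 3"
  have d: "d > 0" using e by (simp add: d_def)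
  obtain J :: nat where J: "real J \<ge> M / d + 1" using real_arch_simple by blast
  \<comment> \<open>\<open>r i\<close> rises from 0 to 1 between (i - J) d and (i - J + 1) d, so
    \<open>r i - r (Suc i)\<close> lives on [(i - J) d, (i - J + 2) d]. That interval has length 2 e
    / 3 and lies in the ball of radius \<open>e\<close> around any of its points. The size of
    \<open>J\<close> makes the sum telescope to 1 on [-M, M].\<close>
  define r where "r i x = step (x / d + real J - real i)" for i x
  define g where "g i x = f x * (r i x - r (Suc i) x)" for i x
  have r_smooth: "r i \<in> smooth_functions" for i
    using smooth_affine[OF smooth_step_smooth, of "1/d" "real J - real i"]
    by (simp add: r_def[abs_def] add_diff_eq)
  have g_smooth: "g i \<in> smooth_functions" for i
    unfolding g_def by (intro smooth_mult smooth_minus r_smooth f)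
  have "f = (\<lambda>x. \<Sum>i<2*J. g i x)"
  proof
    fix x show "f x = (\<Sum>i<2*J. g i x)"
    proof (cases "\<bar>x\<bar> > M")
      case True
      then show ?thesis by (simp add: g_def out0)
    next
      case False
      have "(\<Sum>i<2*J. g i x) = f x * (\<Sum>i<2*J. r i x - r (Suc i) x)"
        by (simp add: g_def sum_distrib_left)
      also have "(\<Sum>i<2*J. r i x - r (Suc i) x) = r 0 x - r (2 * J) x"
        by (rule sum_lessThan_telescope')
      also have "r 0 x = 1"
      proof -
        have "- x / d \<le> M / d" using False d by (intro divide_right_mono) auto
        then show ?thesis using J by (simp add: r_def smooth_step_1)
      qed
      also have "r (2 * J) x = 0"
      proof -
        have "x / d \<le> M / d" using False d by (intro divide_right_mono) auto
        then show ?thesis using J by (simp add: r_def smooth_step_0)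
      qed
      finally show ?thesis by simp
    qed
  qed
  then have "T f = T (\<lambda>x. \<Sum>i<2*J. g i x)" by (rule arg_cong)
  also have "\<dots> = (\<Sum>i<2*J. T (g i))" by (rule linear_functional_sum[OF _ g_smooth lin]) auto
  also have "\<dots> = (\<Sum>i<2*J. 0)"
  proof (rule sum.cong[OF refl])
    fix i
    define a where "a = (real i - real J) * d"
    define S where "S = closure {x. g i x \<noteq> 0}"
    have "{x. g i x \<noteq> 0} \<subseteq> K \<inter> {a..a + 2 * d}"
    proof
      fix x assume "x \<in> {x. g i x \<noteq> 0}"
      then have fx: "f x \<noteq> 0" and rx: "r i x \<noteq> r (Suc i) x" by (auto simp: g_def)
      have "x \<ge> a"
      proof (rule ccontr)
        assume "\<not> x \<ge> a"
        then have "x / d + real J - real i \<le> 0" using d by (simp add: a_def field_simps)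
        then show False using rx by (simp add: r_def smooth_step_0)
      qed
      moreover have "x \<le> a + 2 * d"
      proof (rule ccontr)
        assume "\<not> x \<le> a + 2 * d"
        then have "x / d + real J - real i \<ge> 2" using d by (simp add: a_def field_simps)
        then show False using rx by (simp add: r_def smooth_step_1)
      qed
      ultimately show "x \<in> K \<inter> {a..a + 2 * d}" using suppK[OF fx] by simp
    qed
    moreover have "compact (K \<inter> {a..a + 2 * d})" using K by (intro compact_Int) auto
    ultimately have S: "S \<subseteq> K \<inter> {a..a + 2 * d}"
      unfolding S_def by (rule closure_minimal[OF _ compact_imp_closed])
    have "compact (S \<inter> (K \<inter> {a..a + 2 * d}))"
      unfolding S_def by (intro closed_Int_compact compact_Int K) auto
    then have cS: "compact S" using S by (simp add: Int_absorb2)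
    show "T (g i) = 0"
    proof (cases "S = {}")
      case True
      then have "g i = (\<lambda>x. 0)" using closure_subset[of "{x. g i x \<noteq> 0}"] by (auto simp: S_def)
      then show ?thesis by (simp add: linear_functional_zero[OF lin])
    next
      case False
      then obtain x where x: "x \<in> S" by blast
      then obtain U where U: "U \<in> G" "ball x e \<subseteq> U" using e(2) S by blast
      have "S \<subseteq> ball x e"
      proof
        fix y assume "y \<in> S"
        then have "y \<in> {a..a + 2 * d}" "x \<in> {a..a + 2 * d}" using x S by auto
        then show "y \<in> ball x e" using e(1) by (simp add: dist_real_def d_def abs_less_iff)
      qed
      then have "g i \<in> test_functions U"
        using U(2) cS g_smooth by (auto simp: test_functions_def S_def)
      then show ?thesis using U(1) by (auto simp: G_def)
    qed
  qed
  finally show ?thesis by simp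
qed

text \<open>Removes the assumption of compact support. Subtracting \<open>f\<close> times a cutoff
  that is 1 near [-R, R] leaves a function that the seminorm bound over [-R, R] does not see, and
  the product with the cutoff falls under the previous lemma.\<close>

lemma distribution_vanishes:
  assumes T: "T \<in> compact_distributions" and supp: "distribution_support T \<subseteq> {-b..b}"
    and f: "f \<in> smooth_functions" and "b' > b" and in0: "\<And>x. \<bar>x\<bar> < b' \<Longrightarrow> f x = 0"
  shows "T f = 0"
proof -
  have lin: "linear_functional T" by (rule compact_distributions_linear[OF T])
  obtain R m C where R: "R > 0" "C \<ge> 0" "seminorm_bounded T R m C"
    using compact_distribution_bounded[OF T] .
  let ?c = "cutoff R 1"
  have c: "?c \<in> smooth_functions" by (rule cutoff_smooth)
  have 1: "T (\<lambda>x. f x * ?c x) = 0"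
    by (rule distribution_vanishes_test[OF T supp smooth_mult[OF f c] \<open>b' > b\<close>, where M = "R + 2"])
       (auto simp: in0 cutoff_0)
  have s: "(\<lambda>x. f x - f x * ?c x) \<in> smooth_functions" by (intro smooth_minus smooth_mult f c)
  have "nth_deriv k (\<lambda>x. f x - f x * ?c x) x = 0" if "x \<in> {-R..R}" for k x
  proof -
    have "nth_deriv k (\<lambda>x. f x - f x * ?c x) x = nth_deriv k (\<lambda>x. 0) x"
      by (rule nth_deriv_cong_open[of "{-(R+1)<..<R+1}"])
         (use that in \<open>auto simp: cutoff_1 abs_le_iff\<close>)
    then show ?thesis by (simp add: nth_deriv_const)
  qed
  then have "\<forall>k\<le>m. \<forall>x\<in>{-R..R}. norm (nth_deriv k (\<lambda>x. f x - f x * ?c x) x) \<le> 0" by simp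
  with R(3) s have "norm (T (\<lambda>x. f x - f x * ?c x)) \<le> C * 0"
    unfolding seminorm_bounded_def by blast
  then have "T f - T (\<lambda>x. f x * ?c x) = 0"
    unfolding linear_functional_diff[OF lin f smooth_mult[OF f c]] by simp
  with 1 show ?thesis by simp
qed

lemma one_plus_power_le:
  fixes r :: real
  assumes "r \<ge> 0"
  shows "(1 + r) ^ m \<le> 2 ^ m * (1 + r\<^sup>2) powr (real m / 2)"
proof -
  have "(1 + r)\<^sup>2 \<le> (2 * sqrt (1 + r\<^sup>2))\<^sup>2"
  proof -
    have "(2 * sqrt (1 + r\<^sup>2))\<^sup>2 = 4 * (1 + r\<^sup>2)" by (simp add: power_mult_distrib)
    also have "\<dots> = (1 + r)\<^sup>2 + ((1 - r)\<^sup>2 + (2 + 2 * r\<^sup>2))"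
      by (simp add: power2_eq_square algebra_simps)
    also have "\<dots> \<ge> (1 + r)\<^sup>2" by simp
    finally show ?thesis .
  qed
  then have "1 + r \<le> 2 * sqrt (1 + r\<^sup>2)" by (rule power2_le_imp_le) simp
  then have "(1 + r) ^ m \<le> (2 * sqrt (1 + r\<^sup>2)) ^ m" using assms by (intro power_mono) auto
  also have "\<dots> = 2 ^ m * (1 + r\<^sup>2) powr (real m / 2)"
  proof -
    have pos: "0 < 1 + r\<^sup>2" by (simp add: add_pos_nonneg)
    have "sqrt (1 + r\<^sup>2) ^ m = ((1 + r\<^sup>2) powr (1 / 2)) powr real m"
      using pos by (simp add: powr_half_sqrt powr_realpow)
    then show ?thesis by (simp add: power_mult_distrib powr_powr)
  qed
  finally show ?thesis .
qed

text \<open>The width d = 1 / (1 + |z|) balances two effects: within distance 2 d of [-b, b] the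
  kernel exceeds the scale exp(b |Im z|) at most by the factor exp(2 d |Im z|) \<le> exp 2, and each
  derivative of the cutoff costs 2 / d, which is linear in |z|. Farther out the product vanishes, so
  the interval [-R, R] of the seminorm bound leaves no trace in the exponent.\<close>

lemma distribution_kernel_growth:
  assumes \<alpha>: "\<alpha> > -1/2" and "b > 0" and T: "T \<in> compact_distributions"
    and supp: "distribution_support T \<subseteq> {-b..b}"
  obtains m c where "c > 0" "\<And>z. norm (T (bessel_struve_kernel \<alpha> (- \<i> * z)))
     \<le> c * (1 + (norm z)\<^sup>2) powr (real m / 2) * exp (b * \<bar>Im z\<bar>)"
proof -
  have lin: "linear_functional T" by (rule compact_distributions_linear[OF T])
  obtain R m C where R: "R > 0" "C \<ge> 0" "seminorm_bounded T R m C"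
    using compact_distribution_bounded[OF T] .
  obtain A where A: "A \<ge> 0" "\<And>k x. k \<le> m \<Longrightarrow> norm (nth_deriv k step x) \<le> A"
    using step_deriv_bounded[of m] by blast
  define D where "D = \<bar>bs_const \<alpha>\<bar> * bs_moment \<alpha> 0"
  have D: "D \<ge> 0" unfolding D_def using bs_moment_nonneg by simp
  \<comment> \<open>Here 8 ^ m collects 4 ^ m from the derivatives and 2 ^ m from
    \<open>one_plus_power_le\<close>. \<open>E\<close> may be 0, so the final constant is
    \<open>E + 1\<close>.\<close>
  define E where "E = C * (A * A * (D * exp 2) * 8 ^ m)"
  have E: "E \<ge> 0" using R A D by (simp add: E_def)
  have "norm (T (bessel_struve_kernel \<alpha> (- \<i> * z)))
     \<le> (E + 1) * (1 + (norm z)\<^sup>2) powr (real m / 2) * exp (b * \<bar>Im z\<bar>)" for z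
  proof -
    let ?S = "bessel_struve_kernel \<alpha> (- \<i> * z)"
    define s where "s = 1 + norm z"
    define d where "d = 1 / s"
    have s: "s \<ge> 1" by (simp add: s_def)
    have d: "d > 0" "1 / d = s" using s by (auto simp: d_def)
    have dIm: "d * \<bar>Im z\<bar> \<le> 1"
      using abs_Im_le_cmod[of z] s by (simp add: d_def s_def field_simps)
    have S: "?S \<in> smooth_functions" by (rule smooth_kernel[OF \<alpha>])
    let ?c = "cutoff b d"
    have c: "?c \<in> smooth_functions" by (rule cutoff_smooth)
    have "T (\<lambda>x. ?S x - ?c x * ?S x) = 0"
      by (rule distribution_vanishes[OF T supp smooth_minus[OF S smooth_mult[OF c S]], of "b + d"])
         (use d in \<open>auto simp: cutoff_1\<close>)
    then have TS: "T ?S = T (\<lambda>x. ?c x * ?S x)"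
      unfolding linear_functional_diff[OF lin S smooth_mult[OF c S]] by simp
    define B where "B = A * A * (D * (exp 2 * exp (b * \<bar>Im z\<bar>))) * (4 * s) ^ m"
    have B: "B \<ge> 0" using A D s by (simp add: B_def)
    have "norm (nth_deriv k (\<lambda>x. ?c x * ?S x) x) \<le> B" if k: "k \<le> m" for k x
    proof (cases "\<bar>x\<bar> \<le> b + 2 * d")
      case True
      \<comment> \<open>In 2 * (2 * s) the inner 2 comes from the cutoff and the outer one from the
        product rule. The j-th derivative of the kernel costs only |z|^j; it is weakened to the base
        2 * s shared by both factors.\<close>
      have "norm (nth_deriv k (\<lambda>x. ?c x * ?S x) x) \<le>
          (A * A) * (D * (exp 2 * exp (b * \<bar>Im z\<bar>))) * (2 * (2 * s)) ^ k"
      proof (rule nth_deriv_mult_bound[OF c S])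
        fix j assume j: "j \<le> k"
        show "norm (nth_deriv j ?c x) \<le> A * A * (2 * s) ^ j"
          using cutoff_deriv_bound[OF A d(1), of m j b x] j k d(2) by simp
        have "norm (bs_fun \<alpha> j (- \<i> * z * of_real x)) \<le> D * exp \<bar>Re (- \<i> * z * of_real x)\<bar>"
          unfolding D_def by (rule bs_fun_sums(2)[OF \<alpha>])
        also have "\<dots> \<le> D * (exp 2 * exp (b * \<bar>Im z\<bar>))"
        proof -
          have "\<bar>Re (- \<i> * z * of_real x)\<bar> = \<bar>x\<bar> * \<bar>Im z\<bar>" by (simp add: abs_mult)
          also have "\<dots> \<le> (b + 2 * d) * \<bar>Im z\<bar>" using True by (intro mult_right_mono) auto
          also have "\<dots> \<le> 2 + b * \<bar>Im z\<bar>" using dIm by (simp add: algebra_simps)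
          finally show ?thesis using D by (intro mult_left_mono) (auto simp: exp_add[symmetric])
        qed
        finally have 1: "norm (bs_fun \<alpha> j (- \<i> * z * of_real x)) \<le> D * (exp 2 * exp (b * \<bar>Im z\<bar>))" .
        have 2: "norm (- \<i> * z) ^ j \<le> (2 * s) ^ j"
          by (intro power_mono) (auto simp: norm_mult s_def)
        have "norm (nth_deriv j ?S x) = norm (- \<i> * z) ^ j * norm (bs_fun \<alpha> j (- \<i> * z * of_real x))"
          unfolding nth_deriv_kernel[OF \<alpha>] by (simp only: norm_mult norm_power)
        also have "\<dots> \<le> (2 * s) ^ j * (D * (exp 2 * exp (b * \<bar>Im z\<bar>)))"
          using 1 2 s by (intro mult_mono) auto
        finally show "norm (nth_deriv j ?S x) \<le> D * (exp 2 * exp (b * \<bar>Im z\<bar>)) * (2 * s) ^ j"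
          by (simp only: mult.commute)
      qed (use A D s in auto)
      also have "\<dots> \<le> B"
      proof -
        have "(2 * (2 * s)) ^ k \<le> (4 * s) ^ m"
          using power_increasing[OF k, of "4 * s"] s by simp
        then show ?thesis unfolding B_def using A D by (intro mult_left_mono) auto
      qed
      finally show ?thesis .
    next
      case False
      have "nth_deriv k (\<lambda>x. ?c x * ?S x) x = nth_deriv k (\<lambda>x. 0) x"
      proof (rule nth_deriv_cong_open[of "{x. b + 2 * d < \<bar>x\<bar>}"])
        show "open {x::real. b + 2 * d < \<bar>x\<bar>}" by (intro open_Collect_less continuous_intros)
      qed (use False d in \<open>auto simp: cutoff_0\<close>)
      then show ?thesis using B by (simp add: nth_deriv_const)
    qed
    then have "norm (T ?S) \<le> C * B"
      unfolding TS using R(3) smooth_mult[OF c S] unfolding seminorm_bounded_def by blast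
    also have "C * B = C * (A * A * (D * exp 2) * 4 ^ m) * exp (b * \<bar>Im z\<bar>) * (1 + norm z) ^ m"
      unfolding B_def s_def power_mult_distrib by (simp only: mult_ac)
    also have "\<dots> \<le> C * (A * A * (D * exp 2) * 4 ^ m) * exp (b * \<bar>Im z\<bar>) *
        (2 ^ m * (1 + (norm z)\<^sup>2) powr (real m / 2))"
      using R A D by (intro mult_left_mono one_plus_power_le) auto
    also have "\<dots> = E * (1 + (norm z)\<^sup>2) powr (real m / 2) * exp (b * \<bar>Im z\<bar>)"
    proof -
      have "(8::real) ^ m = 4 ^ m * 2 ^ m" by (simp flip: power_mult_distrib)
      then show ?thesis by (simp add: E_def mult_ac)
    qed
    also have "\<dots> \<le> (E + 1) * (1 + (norm z)\<^sup>2) powr (real m / 2) * exp (b * \<bar>Im z\<bar>)"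
      by (intro mult_right_mono) auto
    finally show ?thesis .
  qed
  then show ?thesis using that[of "E + 1" m] E by simp
qed

lemma entire_if_sums:
  fixes f :: "complex \<Rightarrow> complex"
  assumes "\<And>w. (\<lambda>n. a n * w ^ n) sums f w"
  shows "f holomorphic_on UNIV"
proof -
  have "f holomorphic_on ball 0 r" for r
    by (rule power_series_holomorphic[of _ _ a]) (use assms in simp)
  then have "f field_differentiable at z" for z
    by (rule holomorphic_on_imp_differentiable_at[of _ "ball 0 (norm z + 1)"]) auto
  then show ?thesis
    by (simp add: holomorphic_on_def field_differentiable_at_within)
qed

lemma transform_entire:
  assumes "\<alpha> > -1/2" "T \<in> compact_distributions"
  shows "(\<lambda>z. T (bessel_struve_kernel \<alpha> (- \<i> * z))) analytic_on UNIV"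
proof -
  let ?a = "\<lambda>n. of_real (bs_const \<alpha> * bs_moment \<alpha> n / fact n) * T (\<lambda>x. of_real x ^ n) * (- \<i>) ^ n"
  have "(\<lambda>z. T (bessel_struve_kernel \<alpha> (- \<i> * z))) holomorphic_on UNIV"
  proof (rule entire_if_sums)
    fix w
    show "(\<lambda>n. ?a n * w ^ n) sums T (bessel_struve_kernel \<alpha> (- \<i> * w))"
      using distribution_kernel_sums[OF assms, of "- \<i> * w"]
      unfolding power_mult_distrib by (simp only: mult.assoc)
  qed
  then show ?thesis by (simp add: analytic_on_open)
qed

section \<open>The Paley-Wiener-Schwartz theorem\<close>

lemma entire_divided_difference:
  assumes "f holomorphic_on UNIV"
  obtains q where "q holomorphic_on UNIV" "\<And>w. f w = f a + (w - a) * q w"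
proof -
  let ?q = "\<lambda>w. if w = a then deriv f a else (f w - f a) / (w - a)"
  have "?q holomorphic_on UNIV" by (rule pole_lemma_open[OF assms open_UNIV])
  moreover have "f w = f a + (w - a) * ?q w" for w by simp
  ultimately show ?thesis using that[of ?q] by blast
qed

text \<open>Pushing the segment \<open>{-R..R}\<close> to the upper half circle turns the divided difference
  \<open>q\<close> into \<open>- \<Phi> z / (w - z)\<close> up to a term that vanishes in the limit.\<close>

lemma integral_divided_difference_upper:
  assumes q: "q holomorphic_on UNIV" and eq: "\<And>w. \<Phi> w = \<Phi> z + (w - z) * q w"
    and K: "\<And>w. Im w \<ge> 0 \<Longrightarrow> norm (\<Phi> w) * (1 + norm w) \<le> K"
  shows "((\<lambda>R. integral {-R..R} (\<lambda>x. q (of_real x))) \<longlongrightarrow> \<i> * pi * \<Phi> z) at_top"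
proof -
  \<comment> \<open>The segment and the half circle have the same endpoints, so with a primitive of
    the entire function \<open>q\<close> both integrals are differences of the same two
    values.\<close>
  obtain Q where Q: "\<And>x. (Q has_field_derivative q x) (at x)"
    using holomorphic_convex_primitive'[OF convex_UNIV open_UNIV q] by auto
  have contq: "continuous_on S q" for S
    using Q by (meson holomorphic_on_imp_continuous_on holomorphic_on_subset q subset_UNIV)
  have K0: "K \<ge> 0" using order_trans[OF _ K[of 0]] by simp
  define L where "L = K + norm (\<Phi> z) * norm z"
  have bd: "norm (integral {-R..R} (\<lambda>x. q (of_real x)) - \<i> * pi * \<Phi> z) \<le> L / (R - norm z) * pi"
    if R: "R > norm z" for R
  proof -
    have R0: "R > 0" using R norm_ge_zero[of z] by linarith
    have line: "((\<lambda>x. q (of_real x)) has_integral Q (of_real R) - Q (of_real (-R))) {-R..R}"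
    proof (rule fundamental_theorem_of_calculus)
      show "((\<lambda>x. Q (of_real x)) has_vector_derivative q (of_real x)) (at x within {-R..R})" for x
        by (rule has_vector_derivative_real_field) (rule Q)
    qed (use R0 in auto)
    let ?w = "\<lambda>t. of_real R * exp (\<i> * complex_of_real t)"
    have arc: "((\<lambda>t. \<i> * ?w t * q (?w t)) has_integral Q (?w pi) - Q (?w 0)) {0..pi}"
    proof (rule fundamental_theorem_of_calculus)
      show "((\<lambda>t. Q (?w t)) has_vector_derivative \<i> * ?w t * q (?w t)) (at t within {0..pi})" for t
      proof -
        have "((\<lambda>s. Q (of_real R * exp (\<i> * s))) has_field_derivative q (?w t) * (of_real R * (exp (\<i> * of_real t) * \<i>))) (at (of_real t))"
          by (rule DERIV_chain'[OF _ Q]) (auto intro!: derivative_eq_intros)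
        from has_vector_derivative_real_field[OF this] show ?thesis by (simp add: mult_ac)
      qed
    qed simp
    have "(?w pi :: complex) = of_real (-R)" by simp
    then have "((\<lambda>t. \<i> * ?w t * q (?w t)) has_integral - integral {-R..R} (\<lambda>x. q (of_real x))) {0..pi}"
      using arc line by (simp add: integral_unique)
    from has_integral_add[OF this has_integral_const_real[of "\<i> * \<Phi> z" 0 pi]]
    \<comment> \<open>The constant integrates over [0, pi] to the claimed limit, so the sum is
      exactly the error to be estimated.\<close>
    have *: "((\<lambda>t. \<i> * ?w t * q (?w t) + \<i> * \<Phi> z) has_integral
       - integral {-R..R} (\<lambda>x. q (of_real x)) + \<i> * pi * \<Phi> z) {0..pi}"
      by (simp add: scaleR_conv_of_real mult_ac)
    have "norm (integral {0..pi} (\<lambda>t. \<i> * ?w t * q (?w t) + \<i> * \<Phi> z)) \<le> L / (R - norm z) * (pi - 0)"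
    proof (rule integral_bound)
      show "continuous_on {0..pi} (\<lambda>t. \<i> * ?w t * q (?w t) + \<i> * \<Phi> z)"
        by (intro continuous_intros continuous_on_compose2[OF contq[of UNIV]]) auto
      fix t assume t: "t \<in> {0..pi}"
      let ?v = "?w t"
      have nv: "norm ?v = R" using R0 by (simp add: norm_mult)
      have ge: "norm (?v - z) \<ge> R - norm z" using norm_triangle_ineq2[of ?v z] nv by simp
      then have ne: "?v - z \<noteq> 0" using R by auto
      have "Im ?v \<ge> 0" using t R0 by (simp add: Im_exp sin_ge_zero)
      from K[OF this] have "norm (\<Phi> ?v) * R \<le> K" using nv
        by (smt (verit) mult_left_mono norm_ge_zero)
      \<comment> \<open>Multiplying by v - z eliminates \<open>q\<close>. What remains is bounded by
        \<open>L\<close> through the hypothesis on \<open>K\<close>, and dividing back by v - z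
        makes it small for large R.\<close>
      have "(\<i> * ?v * q ?v + \<i> * \<Phi> z) * (?v - z) = \<i> * (\<Phi> ?v * ?v - \<Phi> z * z)"
        unfolding eq[of ?v] by (simp add: algebra_simps)
      then have "\<i> * ?v * q ?v + \<i> * \<Phi> z = \<i> * (\<Phi> ?v * ?v - \<Phi> z * z) / (?v - z)"
        using ne by (simp add: field_simps)
      then have "norm (\<i> * ?v * q ?v + \<i> * \<Phi> z) = norm (\<Phi> ?v * ?v - \<Phi> z * z) / norm (?v - z)"
        by (simp add: norm_mult norm_divide)
      also have "\<dots> \<le> L / (R - norm z)"
      proof (rule frac_le)
        have "norm (\<Phi> ?v * ?v - \<Phi> z * z) \<le> norm (\<Phi> ?v) * R + norm (\<Phi> z) * norm z"
          using norm_triangle_ineq4[of "\<Phi> ?v * ?v" "\<Phi> z * z"] nv by (simp add: norm_mult)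
        then show "norm (\<Phi> ?v * ?v - \<Phi> z * z) \<le> L"
          using \<open>norm (\<Phi> ?v) * R \<le> K\<close> by (simp add: L_def)
        show "0 \<le> L" using K0 by (simp add: L_def)
      qed (use R ge in auto)
      finally show "norm (\<i> * ?v * q ?v + \<i> * \<Phi> z) \<le> L / (R - norm z)" .
    qed simp
    with integral_unique[OF *] show ?thesis by (simp add: norm_minus_commute)
  qed
  have "((\<lambda>R. L / (R - norm z) * pi) \<longlongrightarrow> 0 * pi) at_top"
    by (intro tendsto_intros tendsto_divide_0[OF tendsto_const] filterlim_at_top_imp_at_infinity
        filterlim_tendsto_add_at_top[OF tendsto_const[of "- norm z"] filterlim_ident, simplified])
  then have lim: "((\<lambda>R. L / (R - norm z) * pi) \<longlongrightarrow> 0) at_top" by simp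
  have "\<forall>\<^sub>F R in at_top. norm (integral {-R..R} (\<lambda>x. q (of_real x)) - \<i> * pi * \<Phi> z) \<le> L / (R - norm z) * pi"
    using eventually_gt_at_top[of "norm z"] by eventually_elim (rule bd)
  from Lim_null_comparison[OF this lim] show ?thesis by (rule LIM_zero_cancel)
qed

text \<open>The reflection w to -w exchanges the half planes and preserves symmetric segments. It
  turns the divided difference \<open>q\<close> into -q(-w), whence the opposite sign.\<close>

lemma integral_divided_difference_lower:
  assumes q: "q holomorphic_on UNIV" and eq: "\<And>w. \<Phi> w = \<Phi> z + (w - z) * q w"
    and K: "\<And>w. Im w \<le> 0 \<Longrightarrow> norm (\<Phi> w) * (1 + norm w) \<le> K"
  shows "((\<lambda>R. integral {-R..R} (\<lambda>x. q (of_real x))) \<longlongrightarrow> - (\<i> * pi * \<Phi> z)) at_top"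
proof -
  let ?q = "\<lambda>w. - q (- w)"
  have "?q holomorphic_on UNIV"
    by (intro holomorphic_intros holomorphic_on_compose_gen[OF _ q, unfolded o_def]) auto
  moreover have "\<Phi> (- w) = \<Phi> (- (- z)) + (w - - z) * ?q w" for w
    using eq[of "- w"] by (simp add: algebra_simps)
  moreover have "norm (\<Phi> (- w)) * (1 + norm w) \<le> K" if "Im w \<ge> 0" for w
    using K[of "- w"] that by simp
  ultimately have "((\<lambda>R. integral {-R..R} (\<lambda>x. ?q (of_real x))) \<longlongrightarrow> \<i> * pi * \<Phi> (- (- z))) at_top"
    by (rule integral_divided_difference_upper)
  moreover have "integral {-R..R} (\<lambda>x. ?q (of_real x)) = - integral {-R..R} (\<lambda>x. q (of_real x))" for R
    using Henstock_Kurzweil_Integration.integral_reflect_real[of R "-R" "\<lambda>x. q (of_real x)"] by simp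
  ultimately have "((\<lambda>R. - integral {-R..R} (\<lambda>x. q (of_real x))) \<longlongrightarrow> \<i> * pi * \<Phi> z) at_top"
    by simp
  from tendsto_minus[OF this] show ?thesis by simp
qed

lemma integrable_one_plus_square: "integrable lborel (\<lambda>x::real. inverse (1 + x\<^sup>2))"
proof -
  have "set_integrable lborel (einterval (-\<infinity>) \<infinity>) (\<lambda>x. inverse (1 + x\<^sup>2))"
  proof (rule interval_integral_FTC_nonneg)
    show "((arctan \<circ> real_of_ereal) \<longlongrightarrow> - (pi / 2)) (at_right (-\<infinity>))"
      "((arctan \<circ> real_of_ereal) \<longlongrightarrow> pi / 2) (at_left \<infinity>)"
      by (auto simp: ereal_tendsto_simps tendsto_arctan_at_top tendsto_arctan_at_bot)
    show "isCont (\<lambda>x. inverse (1 + x\<^sup>2)) x" for x :: real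
    proof -
      have "1 + x\<^sup>2 \<noteq> 0" using zero_le_power2[of x] by linarith
      then show ?thesis by (intro continuous_intros) auto
    qed
  qed (auto intro!: AE_I2 DERIV_arctan)
  then show ?thesis by (simp add: set_integrable_def)
qed

lemma
  shows nth_deriv_exp: "nth_deriv k (\<lambda>x. exp (l * of_real x)) = (\<lambda>x. l ^ k * exp (l * of_real x))"
    and smooth_exp: "(\<lambda>x. exp (l * of_real x)) \<in> smooth_functions"
proof -
  let ?d = "\<lambda>k x. l ^ k * exp (l * complex_of_real x)"
  have d: "(?d k has_vector_derivative ?d (Suc k) x) (at x)" for k x
  proof -
    have "((\<lambda>z. l ^ k * exp (l * z)) has_field_derivative l ^ k * (exp (l * of_real x) * l)) (at (of_real x))"
      by (auto intro!: derivative_eq_intros)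
    from has_vector_derivative_real_field[OF this] show ?thesis by (simp add: mult_ac)
  qed
  show "nth_deriv k (\<lambda>x. exp (l * of_real x)) = ?d k"
    by (rule nth_deriv_eqI[where d = ?d]) (use d in auto)
  show "(\<lambda>x. exp (l * of_real x)) \<in> smooth_functions"
    by (rule smoothI[where d = ?d]) (use d in auto)
qed

lemma distribution_exp_sums:
  assumes "T \<in> compact_distributions"
  shows "(\<lambda>n. T (\<lambda>x. of_real x ^ n) / fact n * l ^ n) sums T (\<lambda>x. exp (l * of_real x))"
proof -
  let ?e = "\<lambda>n. l ^ n /\<^sub>R fact n"
  have s: "(\<lambda>n. ?e n * z ^ n) sums exp (l * z)" for z
    using exp_converges[of "l * z"] by (simp add: power_mult_distrib)
  have "(\<lambda>n. ?e n * T (\<lambda>x. of_real x ^ n)) sums T (\<lambda>x. \<Sum>n. ?e n * of_real x ^ n)"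
    by (rule distribution_power_series[OF assms]) (use s in \<open>auto dest: sums_summable\<close>)
  moreover have "(\<lambda>x. \<Sum>n. ?e n * of_real x ^ n) = (\<lambda>x. exp (l * of_real x))"
    using sums_unique[OF s] by auto
  ultimately show ?thesis by (simp add: scaleR_conv_of_real field_simps)
qed

lemma exp_integral:
  fixes \<mu> :: complex
  assumes "\<mu> \<noteq> 0" "b \<ge> 0"
  shows "((\<lambda>x. exp (\<mu> * of_real x)) has_integral (exp (\<mu> * of_real b) - exp (- (\<mu> * of_real b))) / \<mu>) {-b..b}"
proof -
  have "((\<lambda>x. exp (\<mu> * of_real x)) has_integral
      exp (\<mu> * of_real b) / \<mu> - exp (\<mu> * of_real (-b)) / \<mu>) {-b..b}"
  proof (rule fundamental_theorem_of_calculus)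
    fix x
    have "((\<lambda>z. exp (\<mu> * z) / \<mu>) has_field_derivative exp (\<mu> * of_real x)) (at (of_real x))"
      using assms by (auto intro!: derivative_eq_intros)
    from has_vector_derivative_real_field[OF this]
    show "((\<lambda>x. exp (\<mu> * of_real x) / \<mu>) has_vector_derivative exp (\<mu> * of_real x)) (at x within {-b..b})" .
  qed (use assms in auto)
  then show ?thesis by (simp add: diff_divide_distrib)
qed

text \<open>Contour arguments compute limits over growing segments; dominated convergence identifies
  them with the Lebesgue integral.\<close>

lemma integral_symmetric_limit:
  fixes h :: "real \<Rightarrow> complex"
  assumes "integrable lborel h"
  shows "(\<lambda>n. integral {- real n..real n} h) \<longlonglongrightarrow> (LBINT x. h x)"
proof -
  have eq: "integral {- real n..real n} h = (LBINT x. indicator {- real n..real n} x *\<^sub>R h x)" for n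
  proof -
    have "set_integrable lborel {- real n..real n} h"
      unfolding set_integrable_def using assms by (rule integrable_mult_indicator[rotated]) simp
    from set_borel_integral_eq_integral(2)[OF this] show ?thesis
      by (simp add: set_lebesgue_integral_def)
  qed
  have "(\<lambda>n. LBINT x. indicator {- real n..real n} x *\<^sub>R h x) \<longlonglongrightarrow> (LBINT x. h x)"
  proof (rule integral_dominated_convergence[where w = "\<lambda>x. norm (h x)"])
    show "AE x in lborel. (\<lambda>n. indicator {- real n..real n} x *\<^sub>R h x) \<longlonglongrightarrow> h x"
    proof (rule AE_I2)
      fix x
      obtain N :: nat where N: "\<bar>x\<bar> \<le> real N" using real_arch_simple by blast
      have "\<forall>\<^sub>F n in sequentially. indicator {- real n..real n} x *\<^sub>R h x = h x"
        using eventually_ge_at_top[of N] by eventually_elim (use N in \<open>auto simp: indicator_def\<close>)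
      then show "(\<lambda>n. indicator {- real n..real n} x *\<^sub>R h x) \<longlonglongrightarrow> h x"
        by (rule tendsto_eventually)
    qed
  qed (use assms in \<open>auto simp: indicator_def\<close>)
  then show ?thesis unfolding eq .
qed

text \<open>The seminorm bound over [-b, b] stands for the support condition: unlike a statement
  about \<open>distribution_support\<close>, it is inherited directly under differentiation
  (\<open>fourier_rep_step\<close>) and dilation (\<open>dilate_functional\<close>).\<close>

definition fourier_rep :: "real \<Rightarrow> (complex \<Rightarrow> complex) \<Rightarrow> bool" where
  "fourier_rep b G \<longleftrightarrow> (\<exists>T. linear_functional T \<and> (\<exists>m C. seminorm_bounded T b m C) \<and>
     (\<forall>z. T (\<lambda>x. exp (- \<i> * z * of_real x)) = G z))"

text \<open>The functional is integration against the inverse Fourier transform of \<open>G\<close> on \<open>{-b..b}\<close>, written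
  with the order of integration exchanged.\<close>

lemma fourier_rep_quadratic_decay:
  assumes b: "b > 0" and G: "G holomorphic_on UNIV"
    and bd: "\<And>z. norm (G z) * (1 + norm z)\<^sup>2 \<le> C * exp (b * \<bar>Im z\<bar>)"
  shows "fourier_rep b G"
proof -
  have C0: "C \<ge> 0" using order_trans[OF _ bd[of 0]] by simp
  have contG: "continuous_on S G" for S
    using G holomorphic_on_imp_continuous_on holomorphic_on_subset by blast
  define I where "I \<phi> \<xi> = integral {-b..b} (\<lambda>x. exp (\<i> * of_real \<xi> * of_real x) * \<phi> x)" for \<phi> :: "real \<Rightarrow> complex" and \<xi> :: real
  define h where "h \<phi> \<xi> = G (of_real \<xi>) * I \<phi> \<xi>" for \<phi> \<xi>
  define T where "T \<phi> = (LBINT \<xi>. h \<phi> \<xi>) / (2 * pi)" for \<phi>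
  have inner: "continuous_on {-b..b} (\<lambda>x. exp (\<i> * of_real \<xi> * of_real x) * \<phi> x)"
    if "\<phi> \<in> smooth_functions" for \<phi> \<xi>
    by (intro continuous_intros smooth_continuous that)
  have Ibd: "norm (I \<phi> \<xi>) \<le> B * (2 * b)"
    if \<phi>: "\<phi> \<in> smooth_functions" and B: "\<And>x. x \<in> {-b..b} \<Longrightarrow> norm (\<phi> x) \<le> B" for \<phi> \<xi> B
  proof -
    have "norm (I \<phi> \<xi>) \<le> B * (b - (-b))"
      unfolding I_def by (rule integral_bound) (use b B inner[OF \<phi>] in \<open>auto simp: norm_mult\<close>)
    then show ?thesis by simp
  qed
  have hbd: "norm (h \<phi> \<xi>) \<le> C * (B * (2 * b)) * inverse (1 + \<xi>\<^sup>2)"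
    if \<phi>: "\<phi> \<in> smooth_functions" and B: "\<And>x. x \<in> {-b..b} \<Longrightarrow> norm (\<phi> x) \<le> B" for \<phi> \<xi> B
  proof -
    have pos: "1 + \<xi>\<^sup>2 > 0" using zero_le_power2[of \<xi>] by linarith
    have "1 + \<xi>\<^sup>2 \<le> (1 + norm (complex_of_real \<xi>))\<^sup>2" by (simp add: power2_sum)
    then have "norm (G (of_real \<xi>)) * (1 + \<xi>\<^sup>2) \<le> norm (G (of_real \<xi>)) * (1 + norm (complex_of_real \<xi>))\<^sup>2"
      by (intro mult_left_mono) auto
    also have "\<dots> \<le> C" using bd[of "of_real \<xi>"] by simp
    finally have "norm (G (of_real \<xi>)) \<le> C * inverse (1 + \<xi>\<^sup>2)" using pos by (simp add: field_simps)
    then have "norm (h \<phi> \<xi>) \<le> (C * inverse (1 + \<xi>\<^sup>2)) * (B * (2 * b))"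
      unfolding h_def norm_mult using Ibd[OF \<phi> B, of \<xi>] C0 pos by (intro mult_mono) auto
    then show ?thesis by (simp add: mult_ac)
  qed
  have hint: "integrable lborel (h \<phi>)" if \<phi>: "\<phi> \<in> smooth_functions" for \<phi>
  proof -
    have "compact (\<phi> ` {-b..b})" by (intro compact_continuous_image smooth_continuous \<phi>) auto
    from compact_imp_bounded[OF this] obtain B where B: "\<And>x. x \<in> {-b..b} \<Longrightarrow> norm (\<phi> x) \<le> B"
      unfolding bounded_iff by blast
    have "continuous_on (UNIV \<times> cbox (-b) b) (\<lambda>(\<xi>, x). exp (\<i> * of_real \<xi> * of_real x) * \<phi> x)"
      unfolding split_beta
      by (intro continuous_intros continuous_on_compose2[OF smooth_continuous[OF \<phi>, of UNIV]]) auto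
    from integral_continuous_on_param[OF this] have "continuous_on UNIV (I \<phi>)"
      by (simp add: I_def[abs_def])
    then have "continuous_on UNIV (h \<phi>)" unfolding h_def[abs_def]
      by (intro continuous_intros continuous_on_compose2[OF contG[of UNIV]]) auto
    then have "h \<phi> \<in> borel_measurable lborel" by (simp add: borel_measurable_continuous_onI)
    moreover have "AE \<xi> in lborel. norm (h \<phi> \<xi>) \<le> norm (C * (B * (2 * b)) * inverse (1 + \<xi>\<^sup>2))"
      using hbd[OF \<phi> B] by (intro AE_I2) (smt (verit) real_norm_def)
    moreover have "integrable lborel (\<lambda>\<xi>. C * (B * (2 * b)) * inverse (1 + \<xi>\<^sup>2))"
      by (intro integrable_mult_right integrable_one_plus_square)
    ultimately show ?thesis using Bochner_Integration.integrable_bound by blast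
  qed
  have "linear_functional T"
    unfolding linear_functional_def
  proof (intro conjI ballI allI)
    fix f g c assume f: "f \<in> smooth_functions"
    have "h (\<lambda>x. c * f x) = (\<lambda>\<xi>. c * h f \<xi>)"
      by (auto simp: h_def I_def mult_ac simp flip: integral_mult_right)
    then show "T (\<lambda>x. c * f x) = c * T f" by (simp add: T_def)
    assume g: "g \<in> smooth_functions"
    have "I (\<lambda>x. f x + g x) \<xi> = I f \<xi> + I g \<xi>" for \<xi>
      unfolding I_def distrib_left
      by (intro Henstock_Kurzweil_Integration.integral_add integrable_continuous_real inner f g)
    then have "h (\<lambda>x. f x + g x) = (\<lambda>\<xi>. h f \<xi> + h g \<xi>)" by (auto simp: h_def algebra_simps)
    then show "T (\<lambda>x. f x + g x) = T f + T g"
      using hint[OF f] hint[OF g] by (simp add: T_def add_divide_distrib)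
  qed
  moreover have "seminorm_bounded T b 0 (C * (2 * b) * (LBINT \<xi>. inverse (1 + \<xi>\<^sup>2)) / (2 * pi))"
    unfolding seminorm_bounded_def
  proof (intro ballI allI impI)
    fix f B assume f: "f \<in> smooth_functions"
      and "\<forall>k\<le>0. \<forall>x\<in>{-b..b}. norm (nth_deriv k f x) \<le> B"
    then have B: "\<And>x. x \<in> {-b..b} \<Longrightarrow> norm (f x) \<le> B" by simp
    have "norm (LBINT \<xi>. h f \<xi>) \<le> (LBINT \<xi>. norm (h f \<xi>))" by (rule integral_norm_bound)
    also have "\<dots> \<le> (LBINT \<xi>. C * (B * (2 * b)) * inverse (1 + \<xi>\<^sup>2))"
      by (intro integral_mono integrable_norm hint f integrable_mult_right integrable_one_plus_square hbd B)
    also have "\<dots> = C * (B * (2 * b)) * (LBINT \<xi>. inverse (1 + \<xi>\<^sup>2))" by simp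
    finally show "norm (T f) \<le> C * (2 * b) * (LBINT \<xi>. inverse (1 + \<xi>\<^sup>2)) / (2 * pi) * B"
      by (simp add: T_def norm_divide field_simps)
  qed
  moreover have "T (\<lambda>x. exp (- \<i> * z * of_real x)) = G z" for z
  proof -
    let ?e = "\<lambda>x. exp (- \<i> * z * of_real x)"
    \<comment> \<open>\<open>?P\<close> and \<open>?M\<close> carry the boundary exponentials at x =
      b and x = -b. Both equal G z at w = z, so only their entire divided differences enter and a
      real z causes no pole on the line.\<close>
    let ?P = "\<lambda>w. G w * exp (\<i> * (w - z) * of_real b)"
    let ?M = "\<lambda>w. G w * exp (- (\<i> * (w - z) * of_real b))"
    have hol: "?P holomorphic_on UNIV" "?M holomorphic_on UNIV" by (intro holomorphic_intros G)+
    obtain p where p: "p holomorphic_on UNIV" "\<And>w. ?P w = ?P z + (w - z) * p w"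
      using entire_divided_difference[OF hol(1), of z] by blast
    obtain m where m: "m holomorphic_on UNIV" "\<And>w. ?M w = ?M z + (w - z) * m w"
      using entire_divided_difference[OF hol(2), of z] by blast
    \<comment> \<open>First order decay is what the half circles need; the second order gives
      integrability on the real line in \<open>hbd\<close>.\<close>
    have growth: "norm (G w) * (1 + norm w) \<le> C * exp (b * \<bar>Im w\<bar>)" for w
    proof -
      have "1 + norm w \<le> (1 + norm w)\<^sup>2" using self_le_power[of "1 + norm w" 2] by simp
      then have "norm (G w) * (1 + norm w) \<le> norm (G w) * (1 + norm w)\<^sup>2" by (intro mult_left_mono) auto
      then show ?thesis using bd[of w] by linarith
    qed
    \<comment> \<open>In the upper half plane the factor exp(- b Im w) of |?P w| absorbs exp(b |Im
      w|); \<open>?M\<close> behaves likewise in the lower half plane.\<close>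
    have limP: "((\<lambda>R. integral {-R..R} (\<lambda>x. p (of_real x))) \<longlongrightarrow> \<i> * pi * ?P z) at_top"
    proof (rule integral_divided_difference_upper[OF p, where K = "C * exp (b * Im z)"])
      fix w :: complex assume w: "Im w \<ge> 0"
      have "norm (?P w) * (1 + norm w) = (norm (G w) * (1 + norm w)) * exp (b * Im z - b * Im w)"
        by (simp add: norm_mult algebra_simps)
      also have "\<dots> \<le> (C * exp (b * \<bar>Im w\<bar>)) * exp (b * Im z - b * Im w)"
        by (intro mult_right_mono growth) auto
      also have "\<dots> = C * exp (b * Im z)" using w by (simp add: exp_add[symmetric] mult.assoc)
      finally show "norm (?P w) * (1 + norm w) \<le> C * exp (b * Im z)" .
    qed
    have limM: "((\<lambda>R. integral {-R..R} (\<lambda>x. m (of_real x))) \<longlongrightarrow> - (\<i> * pi * ?M z)) at_top"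
    proof (rule integral_divided_difference_lower[OF m, where K = "C * exp (- (b * Im z))"])
      fix w :: complex assume w: "Im w \<le> 0"
      have "norm (?M w) * (1 + norm w) = (norm (G w) * (1 + norm w)) * exp (b * Im w - b * Im z)"
        by (simp add: norm_mult algebra_simps)
      also have "\<dots> \<le> (C * exp (b * \<bar>Im w\<bar>)) * exp (b * Im w - b * Im z)"
        by (intro mult_right_mono growth) auto
      also have "\<dots> = C * exp (- (b * Im z))" using w by (simp add: exp_add[symmetric] mult.assoc)
      finally show "norm (?M w) * (1 + norm w) \<le> C * exp (- (b * Im z))" .
    qed
    \<comment> \<open>For real z the denominator \<mu> vanishes at \<xi> = Re z. This single point
      is negligible in the integral below.\<close>
    have hpm: "h ?e \<xi> = - \<i> * (p (of_real \<xi>) - m (of_real \<xi>))" if "\<xi> \<noteq> Re z" for \<xi>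
    proof -
      define \<mu> where "\<mu> = \<i> * (of_real \<xi> - z)"
      have ne: "of_real \<xi> - z \<noteq> 0" using that by auto
      then have "\<mu> \<noteq> 0" by (simp add: \<mu>_def)
      have "(\<lambda>x. exp (\<i> * of_real \<xi> * of_real x) * ?e x) = (\<lambda>x. exp (\<mu> * of_real x))"
        by (auto simp: \<mu>_def algebra_simps simp flip: exp_add)
      then have "I ?e \<xi> = (exp (\<mu> * of_real b) - exp (- (\<mu> * of_real b))) / \<mu>"
        unfolding I_def using exp_integral[OF \<open>\<mu> \<noteq> 0\<close>, of b] b by (simp add: integral_unique)
      then have "I ?e \<xi> * \<mu> = exp (\<mu> * of_real b) - exp (- (\<mu> * of_real b))"
        using \<open>\<mu> \<noteq> 0\<close> by simp
      then have "h ?e \<xi> * \<mu> = G (of_real \<xi>) * (exp (\<mu> * of_real b) - exp (- (\<mu> * of_real b)))"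
        by (simp only: h_def mult.assoc)
      also have "\<dots> = ?P (of_real \<xi>) - ?M (of_real \<xi>)"
        unfolding \<mu>_def by (rule right_diff_distrib)
      also have "\<dots> = (of_real \<xi> - z) * (p (of_real \<xi>) - m (of_real \<xi>))"
        unfolding p(2)[of "of_real \<xi>"] m(2)[of "of_real \<xi>"] by (simp add: algebra_simps)
      also have "\<dots> = (- \<i> * (p (of_real \<xi>) - m (of_real \<xi>))) * \<mu>" by (simp add: \<mu>_def algebra_simps)
      finally show ?thesis using \<open>\<mu> \<noteq> 0\<close> by (metis mult_right_cancel)
    qed
    have ci: "(\<lambda>x. q (of_real x)) integrable_on {-R..R}" if "q holomorphic_on UNIV" for q :: "complex \<Rightarrow> complex" and R
      by (intro integrable_continuous_real continuous_on_compose2[OF holomorphic_on_imp_continuous_on[OF that]])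
         (auto intro!: continuous_intros)
    have int_eq: "integral {-R..R} (h ?e) =
        - \<i> * (integral {-R..R} (\<lambda>x. p (of_real x)) - integral {-R..R} (\<lambda>x. m (of_real x)))" for R
    proof -
      have "integral {-R..R} (h ?e) = integral {-R..R} (\<lambda>x. - \<i> * (p (of_real x) - m (of_real x)))"
        by (rule integral_spike[of "{Re z}"]) (use hpm in auto)
      also have "\<dots> = - \<i> * integral {-R..R} (\<lambda>x. p (of_real x) - m (of_real x))"
        by (rule Henstock_Kurzweil_Integration.integral_mult_right)
      also have "integral {-R..R} (\<lambda>x. p (of_real x) - m (of_real x)) =
         integral {-R..R} (\<lambda>x. p (of_real x)) - integral {-R..R} (\<lambda>x. m (of_real x))"
        by (rule Henstock_Kurzweil_Integration.integral_diff[OF ci[OF p(1)] ci[OF m(1)]])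
      finally show ?thesis .
    qed
    \<comment> \<open>As \<open>?P z\<close> and \<open>?M z\<close> are both G z, the two half
      planes contribute pi * G z each, which the 2 * pi in \<open>T\<close> normalises.\<close>
    have "((\<lambda>R. integral {-R..R} (h ?e)) \<longlongrightarrow> - \<i> * (\<i> * pi * ?P z - - (\<i> * pi * ?M z))) at_top"
      unfolding int_eq by (intro tendsto_intros limP limM)
    then have "((\<lambda>R. integral {-R..R} (h ?e)) \<longlongrightarrow> 2 * pi * G z) at_top"
      by (simp add: algebra_simps)
    from filterlim_compose[OF this filterlim_real_sequentially]
    have "(\<lambda>n. integral {- real n..real n} (h ?e)) \<longlonglongrightarrow> 2 * pi * G z" .
    moreover have "(\<lambda>n. integral {- real n..real n} (h ?e)) \<longlonglongrightarrow> (LBINT \<xi>. h ?e \<xi>)"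
      by (rule integral_symmetric_limit[OF hint[OF smooth_exp]])
    ultimately have "(LBINT \<xi>. h ?e \<xi>) = 2 * pi * G z" by (rule LIMSEQ_unique[rotated])
    then show ?thesis by (simp add: T_def)
  qed
  ultimately show ?thesis unfolding fourier_rep_def by blast
qed

lemma power_series_unique:
  fixes a c :: "nat \<Rightarrow> complex"
  assumes a: "\<And>z. (\<lambda>n. a n * z ^ n) sums f z" and c: "\<And>z. (\<lambda>n. c n * z ^ n) sums f z"
  shows "a n = c n"
proof -
  have d: "(\<lambda>n. (a n - c n) * z ^ n) sums 0" for z
    using sums_diff[OF a c, of z z] by (simp add: left_diff_distrib)
  show ?thesis
  proof (cases "n = 0")
    case True
    then show ?thesis using d[of 0] by simp
  next
    case False
    show ?thesis
    proof (rule ccontr)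
      assume "a n \<noteq> c n"
      then have "a n - c n \<noteq> 0" by simp
      \<comment> \<open>Isolated zeros: a nonzero coefficient would force the zero function to have
        no zeros in a punctured disc.\<close>
      then obtain s where s: "0 < s" "\<And>z. z \<in> cball 0 s - {0::complex} \<Longrightarrow> (0::complex) \<noteq> 0"
        using powser_0_nonzero[of 1 0 "\<lambda>n. a n - c n" "\<lambda>_. 0" n] d False by auto
      have "complex_of_real s \<in> cball 0 s - {0}" using s(1) by simp
      from s(2)[OF this] show False by simp
    qed
  qed
qed

lemma norm_exp_le:
  assumes "x \<in> {-b..b}"
  shows "norm (exp (- \<i> * z * of_real x)) \<le> exp (b * \<bar>Im z\<bar>)"
proof -
  have "x * Im z \<le> \<bar>x\<bar> * \<bar>Im z\<bar>" by (metis abs_ge_self abs_mult)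
  also have "\<dots> \<le> b * \<bar>Im z\<bar>" using assms by (intro mult_right_mono) auto
  finally show ?thesis by (simp add: mult.commute)
qed

section \<open>From polynomial growth to quadratic decay\<close>

definition average :: "real \<Rightarrow> (real \<Rightarrow> complex) \<Rightarrow> complex" where
  "average b f = integral {-b..b} f / of_real (2 * b)"

lemma average_linear: "linear_functional (average b)"
  unfolding linear_functional_def average_def
proof (intro conjI ballI allI)
  fix f g c assume f: "f \<in> smooth_functions"
  show "integral {-b..b} (\<lambda>x. c * f x) / of_real (2 * b) = c * (integral {-b..b} f / of_real (2 * b))"
    by simp
  assume g: "g \<in> smooth_functions"
  have "integral {-b..b} (\<lambda>x. f x + g x) = integral {-b..b} f + integral {-b..b} g"
    by (intro Henstock_Kurzweil_Integration.integral_add integrable_continuous_real smooth_continuous f g)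
  then show "integral {-b..b} (\<lambda>x. f x + g x) / of_real (2 * b) =
      integral {-b..b} f / of_real (2 * b) + integral {-b..b} g / of_real (2 * b)"
    by (simp only: add_divide_distrib)
qed

lemma average_bounded:
  assumes "b > 0"
  shows "seminorm_bounded (average b) b 0 1"
  unfolding seminorm_bounded_def
proof (intro ballI allI impI)
  fix f B assume f: "f \<in> smooth_functions" and B: "\<forall>k\<le>0. \<forall>x\<in>{-b..b}. norm (nth_deriv k f x) \<le> B"
  have "norm (integral {-b..b} f) \<le> B * (b - (-b))"
    by (rule integral_bound) (use assms B f in \<open>auto intro: smooth_continuous\<close>)
  then show "norm (average b f) \<le> 1 * B"
    using assms by (simp add: average_def norm_divide field_simps)
qed

text \<open>This is sin(b z) / (b z). Written as the transform of the mean over [-b, b], it is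
  entire without treating a removable singularity, and it is already represented by a functional on
  [-b, b].\<close>

definition sinc :: "real \<Rightarrow> complex \<Rightarrow> complex" where
  "sinc b z = average b (\<lambda>x. exp (- \<i> * z * of_real x))"

lemma sinc_0: "b > 0 \<Longrightarrow> sinc b 0 = 1"
  by (simp add: sinc_def average_def scaleR_conv_of_real)

lemma sinc_entire:
  assumes "b > 0"
  shows "sinc b holomorphic_on UNIV"
proof (rule entire_if_sums)
  fix w
  have "average b \<in> compact_distributions"
    by (rule bounded_imp_compact_distribution[OF average_linear assms average_bounded[OF assms]])
  from distribution_exp_sums[OF this, of "- \<i> * w"]
  show "(\<lambda>n. average b (\<lambda>x. of_real x ^ n) / fact n * (- \<i>) ^ n * w ^ n) sums sinc b w"
    unfolding sinc_def power_mult_distrib by (simp only: mult.assoc)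
qed

text \<open>The mean gives a bound near 0, the explicit integral a factor 1 / (b |z|) away from 0;
  the two estimates are added.\<close>

lemma sinc_decay:
  assumes b: "b > 0"
  shows "norm (sinc b z) * (1 + norm z) \<le> (1 + 1 / b) * exp (b * \<bar>Im z\<bar>)"
proof -
  have 1: "norm (sinc b z) \<le> 1 * exp (b * \<bar>Im z\<bar>)"
    unfolding sinc_def
  proof (rule seminorm_boundedD[OF average_bounded[OF b] smooth_exp])
    fix k x assume "k \<le> (0::nat)" "x \<in> {-b..b}"
    then show "norm (nth_deriv k (\<lambda>x. exp (- \<i> * z * of_real x)) x) \<le> exp (b * \<bar>Im z\<bar>)"
      using norm_exp_le[of x b z] by simp
  qed
  have 2: "norm (sinc b z) * norm z \<le> 1 / b * exp (b * \<bar>Im z\<bar>)"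
  proof (cases "z = 0")
    case True
    then show ?thesis using b by simp
  next
    case False
    define \<mu> where "\<mu> = - \<i> * z"
    have "\<mu> \<noteq> 0" using False by (simp add: \<mu>_def)
    have n\<mu>: "norm \<mu> = norm z" by (simp add: \<mu>_def norm_mult)
    have "norm (exp (\<mu> * of_real b)) \<le> exp (b * \<bar>Im z\<bar>)"
      using norm_exp_le[of b b z] b by (simp add: \<mu>_def)
    moreover have "norm (exp (- (\<mu> * of_real b))) \<le> exp (b * \<bar>Im z\<bar>)"
      using norm_exp_le[of "-b" b z] b by (simp add: \<mu>_def)
    ultimately have le: "norm (exp (\<mu> * of_real b) - exp (- (\<mu> * of_real b))) \<le> 2 * exp (b * \<bar>Im z\<bar>)"
      using norm_triangle_ineq4[of "exp (\<mu> * of_real b)" "exp (- (\<mu> * of_real b))"] by linarith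
    have "sinc b z = (exp (\<mu> * of_real b) - exp (- (\<mu> * of_real b))) / \<mu> / of_real (2 * b)"
      unfolding sinc_def average_def \<mu>_def[symmetric]
      by (simp only: integral_unique[OF exp_integral[OF \<open>\<mu> \<noteq> 0\<close> less_imp_le[OF b]]])
    then have "norm (sinc b z) * norm z =
        norm (exp (\<mu> * of_real b) - exp (- (\<mu> * of_real b))) / (2 * b)"
      using False n\<mu> b by (simp add: norm_divide norm_mult)
    also have "\<dots> \<le> (2 * exp (b * \<bar>Im z\<bar>)) / (2 * b)"
      using le b by (intro divide_right_mono) auto
    finally show ?thesis by simp
  qed
  show ?thesis using 1 2 by (simp add: algebra_simps)
qed

text \<open>The operator \<i> d/dx multiplies exp(- \<i> z x) by z, so multiplying a transform by z
  means differentiating the argument of the functional. This costs one more derivative in the bound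
  and leaves the interval unchanged.\<close>

lemma fourier_rep_step:
  assumes b: "b > 0" and "fourier_rep b G"
  shows "fourier_rep b (\<lambda>z. c * sinc b z + z * G z)"
proof -
  obtain T m C where T: "linear_functional T" "seminorm_bounded T b m C"
    "\<And>z. T (\<lambda>x. exp (- \<i> * z * of_real x)) = G z"
    using assms(2) unfolding fourier_rep_def by blast
  define S where "S f = c * average b f + \<i> * T (nth_deriv 1 f)" for f
  have "linear_functional S"
    unfolding linear_functional_def
  proof (intro conjI ballI allI)
    fix f g k assume f: "f \<in> smooth_functions"
    have "T (nth_deriv 1 (\<lambda>x. k * f x)) = k * T (nth_deriv 1 f)"
      unfolding nth_deriv_scale[OF f] by (rule linear_functional_scale[OF T(1) smooth_nth_deriv[OF f]])
    moreover have "average b (\<lambda>x. k * f x) = k * average b f"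
      by (rule linear_functional_scale[OF average_linear f])
    ultimately show "S (\<lambda>x. k * f x) = k * S f" by (simp add: S_def algebra_simps)
    assume g: "g \<in> smooth_functions"
    have "T (nth_deriv 1 (\<lambda>x. f x + g x)) = T (nth_deriv 1 f) + T (nth_deriv 1 g)"
      unfolding nth_deriv_plus[OF f g] by (rule linear_functional_add[OF T(1) smooth_nth_deriv[OF f] smooth_nth_deriv[OF g]])
    moreover have "average b (\<lambda>x. f x + g x) = average b f + average b g"
      by (rule linear_functional_add[OF average_linear f g])
    ultimately show "S (\<lambda>x. f x + g x) = S f + S g" by (simp add: S_def algebra_simps)
  qed
  moreover have "seminorm_bounded S b (Suc m) (norm c + C)"
    unfolding seminorm_bounded_def
  proof (intro ballI allI impI)
    fix f B assume f: "f \<in> smooth_functions"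
      and B: "\<forall>k\<le>Suc m. \<forall>x\<in>{-b..b}. norm (nth_deriv k f x) \<le> B"
    have "norm (average b f) \<le> 1 * B"
      by (rule seminorm_boundedD[OF average_bounded[OF b] f]) (use B in auto)
    moreover have "norm (T (nth_deriv 1 f)) \<le> C * B"
      by (rule seminorm_boundedD[OF T(2) smooth_nth_deriv[OF f]]) (use B in \<open>simp add: nth_deriv_add\<close>)
    ultimately have "norm c * norm (average b f) + norm (T (nth_deriv 1 f)) \<le> norm c * B + C * B"
      by (intro add_mono mult_left_mono) auto
    moreover have "norm (S f) \<le> norm c * norm (average b f) + norm (T (nth_deriv 1 f))"
      unfolding S_def using norm_triangle_ineq[of "c * average b f" "\<i> * T (nth_deriv 1 f)"]
      by (simp add: norm_mult)
    ultimately show "norm (S f) \<le> (norm c + C) * B" by (simp add: algebra_simps)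
  qed
  moreover have "S (\<lambda>x. exp (- \<i> * z * of_real x)) = c * sinc b z + z * G z" for z
  proof -
    have "T (\<lambda>x. (- \<i> * z) ^ 1 * exp (- \<i> * z * of_real x)) = (- \<i> * z) ^ 1 * G z"
      unfolding T(3)[of z, symmetric] by (rule linear_functional_scale[OF T(1) smooth_exp])
    then show ?thesis unfolding S_def sinc_def nth_deriv_exp by (simp add: algebra_simps)
  qed
  ultimately show ?thesis unfolding fourier_rep_def by blast
qed

text \<open>Dividing by z lowers the degree by one. The function subtracted beforehand has to be of
  exponential type b and to decay like 1 / |z|: in the step from \<open>Suc 0\<close> to 0,
  boundedness of \<open>sinc\<close> on the real line would not be enough.\<close>

lemma fourier_rep_polynomial_growth:
  assumes b: "b > 0" and "G holomorphic_on UNIV"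
    and "\<And>z. norm (G z) * (1 + norm z)\<^sup>2 \<le> C * (1 + norm z) ^ j * exp (b * \<bar>Im z\<bar>)"
  shows "fourier_rep b G"
  using assms(2,3)
proof (induction j arbitrary: G C)
  case 0
  then show ?case using fourier_rep_quadratic_decay[OF b, of G C] by simp
next
  case (Suc j)
  have C0: "C \<ge> 0" using order_trans[OF _ Suc.prems(2)[of 0]] by simp
  let ?f = "\<lambda>z. G z - G 0 * sinc b z"
  have "?f holomorphic_on UNIV" by (intro holomorphic_intros Suc.prems sinc_entire b)
  then obtain q where q: "q holomorphic_on UNIV" "\<And>w. ?f w = ?f 0 + (w - 0) * q w"
    using entire_divided_difference[of ?f 0] by blast
  have G: "G = (\<lambda>z. G 0 * sinc b z + z * q z)"
  proof
    fix z
    have "?f z = z * q z" using q(2)[of z] sinc_0[OF b] by simp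
    then show "G z = G 0 * sinc b z + z * q z" by (simp only: diff_eq_eq add.commute)
  qed
  have "continuous_on (cball 0 1) q"
    using q(1) holomorphic_on_imp_continuous_on holomorphic_on_subset by blast
  then have "compact (q ` cball 0 1)" by (rule compact_continuous_image) simp
  from compact_imp_bounded[OF this] obtain M where M: "M > 0" "\<And>z. norm z \<le> 1 \<Longrightarrow> norm (q z) \<le> M"
    unfolding bounded_pos by auto
  \<comment> \<open>The 2 comes from 1 + |z| \<le> 2 |z| outside the unit disc. Inside, |q z| \<le>
    M and (1 + |z|)^2 \<le> 4 account for the summand 4 * M below.\<close>
  define D where "D = 2 * (C + norm (G 0) * (1 + 1 / b))"
  have D: "D \<ge> 0" using C0 b by (simp add: D_def)
  have "norm (q z) * (1 + norm z)\<^sup>2 \<le> (D + 4 * M) * (1 + norm z) ^ j * exp (b * \<bar>Im z\<bar>)" for z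
  proof -
    define s where "s = 1 + norm z"
    define E where "E = exp (b * \<bar>Im z\<bar>)"
    have s: "s \<ge> 1" by (simp add: s_def)
    have E: "E \<ge> 1" using b by (simp add: E_def)
    have sj: "s ^ j \<ge> 1" using s by (rule one_le_power)
    have sE: "s ^ j * E \<ge> 1" using mult_mono[OF sj E] sj by simp
    show ?thesis
    proof (cases "norm z \<le> 1")
      case True
      have "norm (q z) * s\<^sup>2 \<le> M * 2\<^sup>2"
        using M True by (intro mult_mono power_mono) (auto simp: s_def)
      also have "\<dots> \<le> (D + 4 * M) * (s ^ j * E)"
        using mult_mono[of "4 * M" "D + 4 * M" 1 "s ^ j * E"] D M(1) sE by simp
      finally show ?thesis by (simp add: s_def E_def mult.assoc)
    next
      case False
      have "norm (G z) * s\<^sup>2 \<le> C * s ^ Suc j * E"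
        using Suc.prems(2)[of z] by (simp add: s_def E_def)
      then have "(norm (G z) * s) * s \<le> (C * s ^ j * E) * s"
        by (simp add: power2_eq_square mult_ac)
      then have 1: "norm (G z) * s \<le> C * (s ^ j * E)" using s by (simp add: mult.assoc)
      have "norm (sinc b z) * s \<le> (1 + 1 / b) * E"
        using sinc_decay[OF b, of z] by (simp add: s_def E_def)
      also have "\<dots> \<le> (1 + 1 / b) * (s ^ j * E)"
        using sj E b by (intro mult_left_mono) auto
      finally have 2: "norm (sinc b z) * s \<le> (1 + 1 / b) * (s ^ j * E)" .
      have "norm z * norm (q z) = norm (?f z)"
        using q(2)[of z] sinc_0[OF b] by (simp add: norm_mult)
      also have "\<dots> \<le> norm (G z) + norm (G 0) * norm (sinc b z)"
        using norm_triangle_ineq4[of "G z" "G 0 * sinc b z"] by (simp add: norm_mult)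
      finally have "norm z * norm (q z) * s \<le> (norm (G z) + norm (G 0) * norm (sinc b z)) * s"
        using s by (intro mult_right_mono) auto
      also have "\<dots> = norm (G z) * s + norm (G 0) * (norm (sinc b z) * s)" by (simp add: algebra_simps)
      also have "\<dots> \<le> C * (s ^ j * E) + norm (G 0) * ((1 + 1 / b) * (s ^ j * E))"
        using 1 2 by (intro add_mono mult_left_mono) auto
      finally have 3: "norm z * norm (q z) * s \<le> (C + norm (G 0) * (1 + 1 / b)) * (s ^ j * E)"
        by (simp add: algebra_simps)
      have "norm (q z) * s\<^sup>2 = s * (norm (q z) * s)" by (simp add: power2_eq_square)
      also have "\<dots> \<le> (2 * norm z) * (norm (q z) * s)"
        using False s by (intro mult_right_mono) (auto simp: s_def)
      also have "\<dots> = 2 * (norm z * norm (q z) * s)" by (simp only: mult.assoc)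
      also have "\<dots> \<le> 2 * ((C + norm (G 0) * (1 + 1 / b)) * (s ^ j * E))"
        by (intro mult_left_mono 3) simp
      also have "\<dots> = D * (s ^ j * E)" unfolding D_def by (simp only: mult.assoc)
      also have "\<dots> \<le> (D + 4 * M) * (s ^ j * E)"
        using sE M(1) by (intro mult_right_mono) linarith+
      finally show ?thesis by (simp add: s_def E_def mult.assoc)
    qed
  qed
  then have "fourier_rep b q" by (rule Suc.IH[OF q(1)])
  then show ?case by (subst G) (rule fourier_rep_step[OF b])
qed

section \<open>Euler operators on functions of Paley-Wiener growth\<close>

definition paley_wiener :: "real \<Rightarrow> (complex \<Rightarrow> complex) \<Rightarrow> bool" where
  "paley_wiener b F \<longleftrightarrow> F holomorphic_on UNIV \<and>
     (\<exists>j C. \<forall>z. norm (F z) \<le> C * (1 + norm z) ^ j * exp (b * \<bar>Im z\<bar>))"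

lemma paley_wiener_fourier_rep:
  assumes "b > 0" "paley_wiener b F"
  shows "fourier_rep b F"
proof -
  obtain j C where F: "F holomorphic_on UNIV"
    "\<And>z. norm (F z) \<le> C * (1 + norm z) ^ j * exp (b * \<bar>Im z\<bar>)"
    using assms(2) unfolding paley_wiener_def by blast
  show ?thesis
  proof (rule fourier_rep_polynomial_growth[OF assms(1) F(1)])
    fix z
    have "norm (F z) * (1 + norm z)\<^sup>2 \<le> C * (1 + norm z) ^ j * exp (b * \<bar>Im z\<bar>) * (1 + norm z)\<^sup>2"
      by (rule mult_right_mono[OF F(2)]) simp
    then show "norm (F z) * (1 + norm z)\<^sup>2 \<le> C * (1 + norm z) ^ (j + 2) * exp (b * \<bar>Im z\<bar>)"
      unfolding power_add by (simp only: mult_ac)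
  qed
qed

text \<open>Cauchy's inequality on unit discs gives the derivative the growth of F up to a constant,
  and the factor z costs one more power of 1 + |z|.\<close>

lemma paley_wiener_euler:
  assumes b: "b > 0" and "paley_wiener b F"
  shows "paley_wiener b (\<lambda>z. s * F z + z * deriv F z / 2)"
proof -
  obtain j C where F: "F holomorphic_on UNIV"
    "\<And>z. norm (F z) \<le> C * (1 + norm z) ^ j * exp (b * \<bar>Im z\<bar>)"
    using assms(2) unfolding paley_wiener_def by blast
  have C0: "C \<ge> 0" using order_trans[OF _ F(2)[of 0]] by simp
  \<comment> \<open>On the circle |x - z| = 1 one has 1 + |x| \<le> 2 (1 + |z|) and |Im x| \<le> |Im
    z| + 1.\<close>
  define C' where "C' = C * 2 ^ j * exp b"
  have C'0: "C' \<ge> 0" using C0 by (simp add: C'_def)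
  have dF: "norm (deriv F z) \<le> C' * (1 + norm z) ^ j * exp (b * \<bar>Im z\<bar>)" for z
  proof -
    have "norm ((deriv ^^ 1) F z) \<le> fact 1 * (C' * (1 + norm z) ^ j * exp (b * \<bar>Im z\<bar>)) / 1 ^ 1"
    proof (rule Cauchy_inequality)
      show "F holomorphic_on ball z 1" "continuous_on (cball z 1) F"
        using F(1) holomorphic_on_imp_continuous_on holomorphic_on_subset by blast+
      fix x assume x: "norm (z - x) = 1"
      have "1 + norm x \<le> 2 + norm z" using norm_triangle_ineq2[of x z] x by (simp add: norm_minus_commute)
      also have "\<dots> \<le> 2 * (1 + norm z)" by simp
      finally have "1 + norm x \<le> 2 * (1 + norm z)" .
      then have 1: "(1 + norm x) ^ j \<le> (2 * (1 + norm z)) ^ j" by (intro power_mono) auto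
      have "\<bar>Im x\<bar> \<le> \<bar>Im z\<bar> + 1" using abs_Im_le_cmod[of "z - x"] x by simp
      then have "b * \<bar>Im x\<bar> \<le> b * (\<bar>Im z\<bar> + 1)" using b by (intro mult_left_mono) auto
      then have 2: "exp (b * \<bar>Im x\<bar>) \<le> exp b * exp (b * \<bar>Im z\<bar>)"
        by (simp add: exp_add[symmetric] algebra_simps)
      have "norm (F x) \<le> C * (1 + norm x) ^ j * exp (b * \<bar>Im x\<bar>)" by (rule F(2))
      also have "\<dots> \<le> C * (2 * (1 + norm z)) ^ j * (exp b * exp (b * \<bar>Im z\<bar>))"
        using 1 2 C0 by (intro mult_mono) auto
      also have "\<dots> = C' * (1 + norm z) ^ j * exp (b * \<bar>Im z\<bar>)"
        unfolding C'_def power_mult_distrib by (simp only: mult_ac)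
      finally show "norm (F x) \<le> C' * (1 + norm z) ^ j * exp (b * \<bar>Im z\<bar>)" .
    qed simp
    then show ?thesis by simp
  qed
  have "norm (s * F z + z * deriv F z / 2) \<le> (norm s * C + C') * (1 + norm z) ^ Suc j * exp (b * \<bar>Im z\<bar>)" for z
  proof -
    let ?X = "(1 + norm z) ^ j * exp (b * \<bar>Im z\<bar>)"
    have X: "?X \<le> (1 + norm z) * ?X"
      using mult_right_mono[of 1 "1 + norm z" ?X] by simp
    have "norm (s * F z + z * deriv F z / 2) \<le> norm (s * F z) + norm (z * deriv F z / 2)"
      by (rule norm_triangle_ineq)
    also have "\<dots> \<le> norm s * norm (F z) + norm z * norm (deriv F z)"
      by (simp add: norm_mult norm_divide)
    also have "\<dots> \<le> norm s * (C * ?X) + (1 + norm z) * (C' * ?X)"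
      using F(2)[of z] dF[of z] by (intro add_mono mult_mono) (auto simp: mult.assoc)
    also have "norm s * (C * ?X) \<le> norm s * (C * ((1 + norm z) * ?X))"
      using C0 X by (intro mult_left_mono) auto
    finally show ?thesis by (simp add: algebra_simps)
  qed
  moreover have "(\<lambda>z. s * F z + z * deriv F z / 2) holomorphic_on UNIV"
    by (intro holomorphic_intros F(1)) auto
  ultimately show ?thesis unfolding paley_wiener_def by blast
qed

text \<open>z^n is an eigenvector of s + (z/2) d/dz. Halving the Euler operator matches the steps of
  1/2 in the Gamma arguments of the moments.\<close>

lemma sums_euler:
  fixes a :: "nat \<Rightarrow> complex"
  assumes "\<And>z. (\<lambda>n. a n * z ^ n) sums F z"
  shows "(\<lambda>n. (of_nat n / 2 + s) * a n * z ^ n) sums (s * F z + z * deriv F z / 2)"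
proof -
  have F: "F = (\<lambda>z. \<Sum>n. a n * z ^ n)" using sums_unique[OF assms] by auto
  have sa: "\<And>z. summable (\<lambda>n. a n * z ^ n)" using assms by (blast dest: sums_summable)
  have "(F has_field_derivative (\<Sum>n. diffs a n * z ^ n)) (at z)"
    unfolding F by (rule termdiffs_strong_converges_everywhere[OF sa])
  then have "deriv F z = (\<Sum>n. diffs a n * z ^ n)" by (rule DERIV_imp_deriv)
  with diffs_equiv[OF termdiff_converges_all[OF sa]]
  have "(\<lambda>n. of_nat n * a n * z ^ (n - Suc 0)) sums deriv F z" by simp
  from sums_mult[OF this, of "z / 2"]
  have "(\<lambda>n. z / 2 * (of_nat n * a n * z ^ (n - Suc 0))) sums (z * deriv F z / 2)" by simp
  moreover have "(\<lambda>n. z / 2 * (of_nat n * a n * z ^ (n - Suc 0))) = (\<lambda>n. of_nat n / 2 * a n * z ^ n)"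
  proof
    show "z / 2 * (of_nat n * a n * z ^ (n - Suc 0)) = of_nat n / 2 * a n * z ^ n" for n
      by (cases n) auto
  qed
  ultimately have "(\<lambda>n. of_nat n / 2 * a n * z ^ n) sums (z * deriv F z / 2)" by simp
  from sums_add[OF sums_mult[OF assms[of z], of s] this] show ?thesis
    by (simp add: algebra_simps)
qed

text \<open>The Euler operator with s = 1/2 + k contributes the factor (n + 1)/2 + k; the operators
  for k < N multiply up to the Pochhammer symbol.\<close>

lemma paley_wiener_pochhammer:
  assumes b: "b > 0" and F: "paley_wiener b F" "\<And>z. (\<lambda>n. a n * z ^ n) sums F z"
  obtains H where "paley_wiener b H"
    "\<And>z. (\<lambda>n. of_real (pochhammer ((real n + 1) / 2) N) * a n * z ^ n) sums H z"
proof -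
  have "\<exists>H. paley_wiener b H \<and>
     (\<forall>z. (\<lambda>n. of_real (pochhammer ((real n + 1) / 2) N) * a n * z ^ n) sums H z)"
  proof (induction N)
    case 0
    then show ?case using F by auto
  next
    case (Suc N)
    then obtain H where H: "paley_wiener b H"
      "\<And>z. (\<lambda>n. of_real (pochhammer ((real n + 1) / 2) N) * a n * z ^ n) sums H z" by blast
    let ?H = "\<lambda>z. (1 / 2 + of_nat N) * H z + z * deriv H z / 2"
    have "(\<lambda>n. of_real (pochhammer ((real n + 1) / 2) (Suc N)) * a n * z ^ n) sums ?H z" for z
    proof -
      have "complex_of_real (pochhammer ((real n + 1) / 2) (Suc N)) =
         (of_nat n / 2 + (1 / 2 + of_nat N)) * of_real (pochhammer ((real n + 1) / 2) N)" for n
        by (simp add: pochhammer_Suc add_divide_distrib)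
      then have "(\<lambda>n. complex_of_real (pochhammer ((real n + 1) / 2) (Suc N)) * a n * z ^ n) =
         (\<lambda>n. (of_nat n / 2 + (1 / 2 + of_nat N)) * (of_real (pochhammer ((real n + 1) / 2) N) * a n) * z ^ n)"
        by (simp only: mult.assoc)
      then show ?thesis using sums_euler[OF H(2), of "1 / 2 + of_nat N" z] by (simp only:)
    qed
    with paley_wiener_euler[OF b H(1)] show ?case by blast
  qed
  then show ?thesis using that by blast
qed

section \<open>Erdelyi-Kober dilation means\<close>

definition dilate :: "(real \<Rightarrow> real) \<Rightarrow> (real \<Rightarrow> complex) \<Rightarrow> real \<Rightarrow> complex" where
  "dilate v f x = integral {0..1} (\<lambda>t. of_real (v t) * f (x * t))"

lemma dilate_continuous:
  assumes "continuous_on {0..1} v" "f \<in> smooth_functions"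
  shows "continuous_on {0..1} (\<lambda>t. of_real (v t) * f (x * t))"
  by (intro continuous_intros assms continuous_on_compose2[OF smooth_continuous[OF assms(2), of UNIV]]) auto

lemma
  assumes v: "continuous_on {0..1} v" and f: "f \<in> smooth_functions"
  shows nth_deriv_dilate: "nth_deriv k (dilate v f) = dilate (\<lambda>t. v t * t ^ k) (nth_deriv k f)"
    and smooth_dilate: "dilate v f \<in> smooth_functions"
proof -
  let ?d = "\<lambda>k. dilate (\<lambda>t. v t * t ^ k) (nth_deriv k f)"
  have d: "(?d k has_vector_derivative ?d (Suc k) x) (at x)" for k x
  proof -
    have "((\<lambda>x. integral (cbox 0 1) (\<lambda>t. of_real (v t * t ^ k) * nth_deriv k f (x * t))) has_vector_derivative
        integral (cbox 0 1) (\<lambda>t. of_real (v t * t ^ Suc k) * nth_deriv (Suc k) f (x * t))) (at x within UNIV)"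
    proof (rule leibniz_rule_vector_derivative)
      fix x t :: real
      have "((\<lambda>x. x * t) has_vector_derivative t) (at x)"
        by (auto intro!: derivative_eq_intros
            simp: has_real_derivative_iff_has_vector_derivative[symmetric])
      from has_vector_derivative_mult_right[OF vector_diff_chain_at[OF this smooth_deriv[OF f]], of "of_real (v t * t ^ k)" k]
      show "((\<lambda>x. of_real (v t * t ^ k) * nth_deriv k f (x * t)) has_vector_derivative
          of_real (v t * t ^ Suc k) * nth_deriv (Suc k) f (x * t)) (at x within UNIV)"
        by (simp add: o_def scaleR_conv_of_real mult_ac)
    next
      show "(\<lambda>t. of_real (v t * t ^ k) * nth_deriv k f (x * t)) integrable_on cbox 0 1" for x
        unfolding cbox_interval
        by (intro integrable_continuous_real dilate_continuous smooth_nth_deriv f continuous_intros v)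
    next
      have "continuous_on (UNIV \<times> {0..1}) (\<lambda>p. v (snd p))"
        by (intro continuous_on_compose2[OF v]) (auto intro: continuous_intros)
      then show "continuous_on (UNIV \<times> cbox 0 1)
          (\<lambda>(x, t). of_real (v t * t ^ Suc k) * nth_deriv (Suc k) f (x * t))"
        unfolding split_beta cbox_interval
        by (intro continuous_intros continuous_on_compose2[OF smooth_nth_deriv_continuous[OF f, of UNIV]]) auto
    qed auto
    then show ?thesis by (simp add: dilate_def[abs_def])
  qed
  show "nth_deriv k (dilate v f) = ?d k"
    by (rule nth_deriv_eqI[where d = ?d]) (use d in simp_all)
  show "dilate v f \<in> smooth_functions"
    by (rule smoothI[where d = ?d]) (use d in simp_all)
qed

lemma dilate_add:
  assumes "continuous_on {0..1} v" "f \<in> smooth_functions" "g \<in> smooth_functions"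
  shows "dilate v (\<lambda>x. f x + g x) = (\<lambda>x. dilate v f x + dilate v g x)"
  unfolding dilate_def distrib_left
  by (intro ext Henstock_Kurzweil_Integration.integral_add integrable_continuous_real
      dilate_continuous assms)

lemma dilate_scale: "dilate v (\<lambda>x. c * f x) = (\<lambda>x. c * dilate v f x)"
  by (auto simp: dilate_def mult_ac simp flip: integral_mult_right)

lemma dilate_monomial:
  assumes "continuous_on {0..1} v"
  shows "dilate v (\<lambda>x. of_real x ^ n) = (\<lambda>x. of_real (integral {0..1} (\<lambda>t. v t * t ^ n)) * of_real x ^ n)"
proof
  fix x
  have "dilate v (\<lambda>x. of_real x ^ n) x = integral {0..1} (\<lambda>t. of_real (v t * t ^ n) * of_real x ^ n)"
    by (simp add: dilate_def power_mult_distrib mult_ac)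
  also have "\<dots> = integral {0..1} (\<lambda>t. complex_of_real (v t * t ^ n)) * of_real x ^ n"
    by (rule integral_mult_left)
  also have "integral {0..1} (\<lambda>t. complex_of_real (v t * t ^ n)) = of_real (integral {0..1} (\<lambda>t. v t * t ^ n))"
    using integral_linear[OF integrable_continuous_real bounded_linear_of_real, of 0 1 "\<lambda>t. v t * t ^ n"]
      assms by (simp add: o_def continuous_intros)
  finally show "dilate v (\<lambda>x. of_real x ^ n) x = of_real (integral {0..1} (\<lambda>t. v t * t ^ n)) * of_real x ^ n" .
qed

text \<open>Since |x t| \<le> |x| for t in [0, 1], the derivatives of \<open>dilate v f\<close> on
  [-b, b] involve only those of \<open>f\<close> on [-b, b]. The interval and the order m are
  therefore preserved.\<close>

lemma dilate_functional:
  assumes T: "linear_functional T" "seminorm_bounded T b m C" and v: "continuous_on {0..1} v"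
  shows "linear_functional (\<lambda>f. T (dilate v f))"
    and "\<exists>V. seminorm_bounded (\<lambda>f. T (dilate v f)) b m (C * V)"
proof -
  show "linear_functional (\<lambda>f. T (dilate v f))"
    unfolding linear_functional_def
    by (auto simp: dilate_add[OF v] dilate_scale linear_functional_add[OF T(1)] linear_functional_scale[OF T(1)]
        smooth_dilate[OF v])
  have "compact (v ` {0..1})" by (rule compact_continuous_image[OF v]) simp
  from compact_imp_bounded[OF this] obtain V where V: "V > 0" "\<And>t. 0 \<le> t \<and> t \<le> 1 \<Longrightarrow> \<bar>v t\<bar> \<le> V"
    unfolding bounded_pos by auto
  have "seminorm_bounded (\<lambda>f. T (dilate v f)) b m (C * V)"
    unfolding seminorm_bounded_def
  proof (intro ballI allI impI)
    fix f B assume f: "f \<in> smooth_functions"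
      and B: "\<forall>k\<le>m. \<forall>x\<in>{-b..b}. norm (nth_deriv k f x) \<le> B"
    have "norm (T (dilate v f)) \<le> C * (V * B)"
    proof (rule seminorm_boundedD[OF T(2) smooth_dilate[OF v f]])
      fix k x assume k: "k \<le> m" and x: "x \<in> {-b..b}"
      have "norm (integral {0..1} (\<lambda>t. complex_of_real (v t * t ^ k) * nth_deriv k f (x * t))) \<le> V * B * (1 - 0)"
      proof (rule integral_bound)
        show "continuous_on {0..1} (\<lambda>t. complex_of_real (v t * t ^ k) * nth_deriv k f (x * t))"
          by (intro dilate_continuous smooth_nth_deriv f continuous_intros v)
        fix t :: real assume t: "t \<in> {0..1}"
        have "\<bar>x * t\<bar> \<le> b * 1" unfolding abs_mult using t x by (intro mult_mono) auto
        then have "norm (nth_deriv k f (x * t)) \<le> B" using B k by (auto simp: abs_le_iff)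
        moreover have "norm (complex_of_real (v t * t ^ k)) \<le> V * 1"
          unfolding norm_of_real abs_mult using t V by (intro mult_mono) (auto simp: power_le_one)
        ultimately show "norm (complex_of_real (v t * t ^ k) * nth_deriv k f (x * t)) \<le> V * B"
          unfolding norm_mult using V(1) by (intro mult_mono) auto
      qed simp
      then show "norm (nth_deriv k (dilate v f) x) \<le> V * B"
        unfolding nth_deriv_dilate[OF v f] by (simp add: dilate_def)
    qed
    then show "norm (T (dilate v f)) \<le> C * V * B" by (simp add: mult.assoc)
  qed
  then show "\<exists>V. seminorm_bounded (\<lambda>f. T (dilate v f)) b m (C * V)" by blast
qed

text \<open>Up to normalisation, the weight of an Erdelyi-Kober integral of order \<beta>. The
  exponent 2 \<alpha> + 1 gives the n-th moment the factor Gamma(n/2 + \<alpha> + 1), which stands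
  in the denominator of \<open>bs_moment \<alpha> n\<close>. For \<beta> > 1 the weight is
  continuous up to t = 1.\<close>

definition erdelyi_weight :: "real \<Rightarrow> real \<Rightarrow> real \<Rightarrow> real" where
  "erdelyi_weight \<alpha> \<beta> t = t powr (2 * \<alpha> + 1) * (1 - t\<^sup>2) powr (\<beta> - 1)"

lemma erdelyi_weight_continuous:
  assumes "\<alpha> > -1/2" "\<beta> > 1"
  shows "continuous_on {0..1} (erdelyi_weight \<alpha> \<beta>)"
  unfolding erdelyi_weight_def[abs_def]
  by (intro continuous_on_mult continuous_on_powr' continuous_intros)
     (use assms in \<open>auto simp: power_le_one\<close>)

lemma erdelyi_weight_moment:
  assumes "\<alpha> > -1/2" "\<beta> > 1"
  shows "integral {0..1} (\<lambda>t. erdelyi_weight \<alpha> \<beta> t * t ^ n) = Beta (real n / 2 + \<alpha> + 1) \<beta> / 2"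
proof -
  let ?s = "2 * \<alpha> + 1 + real n"
  note w = powr_weight_integral[of ?s \<beta>]
  have s: "?s > 0" using assms by simp
  have "integral {0..1} (\<lambda>t. erdelyi_weight \<alpha> \<beta> t * t ^ n) =
      integral {0..1} (\<lambda>t. t powr ?s * (1 - t\<^sup>2) powr (\<beta> - 1))"
  proof (rule Henstock_Kurzweil_Integration.integral_cong)
    fix t :: real assume "t \<in> {0..1}"
    then show "erdelyi_weight \<alpha> \<beta> t * t ^ n = t powr ?s * (1 - t\<^sup>2) powr (\<beta> - 1)"
      by (cases "t = 0") (auto simp: erdelyi_weight_def powr_add powr_realpow)
  qed
  also have "\<dots> = Beta ((?s + 1) / 2) \<beta> / 2"
    using w set_borel_integral_eq_integral(2)[OF w(1)] assms s by simp
  also have "(?s + 1) / 2 = real n / 2 + \<alpha> + 1" by (simp add: field_simps)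
  finally show ?thesis .
qed

text \<open>With \<open>\<beta> = N - \<alpha> - 1/2\<close> the Gamma factors of the two moments cancel up to a Pochhammer symbol.\<close>

lemma bs_moment_inverse:
  assumes \<alpha>: "\<alpha> > -1/2" and \<beta>: "\<beta> > 1" and N: "\<alpha> + \<beta> + 1/2 = real N"
  shows "bs_const \<alpha> * bs_moment \<alpha> n * (Beta (real n / 2 + \<alpha> + 1) \<beta> / 2) * pochhammer ((real n + 1) / 2) N =
     bs_const \<alpha> * Gamma (\<alpha> + 1/2) * Gamma \<beta> / 4"
proof -
  let ?x = "(real n + 1) / 2" and ?y = "real n / 2 + \<alpha> + 1"
  have y: "?x + (\<alpha> + 1/2) = ?y" by (simp add: field_simps)
  have xN: "?y + \<beta> = ?x + real N" using N by (simp add: field_simps)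
  have pos: "?x > 0" "?y > 0" "?x + real N > 0" using \<alpha> by (auto intro: add_pos_nonneg)
  then have nz: "Gamma ?x \<noteq> 0" "Gamma ?y \<noteq> 0" "Gamma (?x + real N) \<noteq> 0"
    using Gamma_real_pos by (metis less_irrefl)+
  have "?x \<notin> \<int>\<^sub>\<le>\<^sub>0" using pos(1) by (auto elim!: nonpos_Ints_cases)
  then have p: "pochhammer ?x N = Gamma (?x + real N) / Gamma ?x" by (rule pochhammer_Gamma)
  show ?thesis
    unfolding bs_moment_Beta[OF \<alpha>] Beta_def y xN p using nz by (simp add: field_simps)
qed

lemma bs_const_pos: "\<alpha> > -1/2 \<Longrightarrow> bs_const \<alpha> > 0"
  unfolding bs_const_def by (intro divide_pos_pos mult_pos_pos Gamma_real_pos) auto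

section \<open>Construction of the distribution from its transform\<close>

lemma paley_wiener_distribution:
  assumes \<alpha>: "\<alpha> > -1/2" and b: "b > 0" and F: "paley_wiener b F"
  obtains T where "T \<in> compact_distributions" "distribution_support T \<subseteq> {-b..b}"
    "\<And>z. T (bessel_struve_kernel \<alpha> (- \<i> * z)) = F z"
proof -
  \<comment> \<open>This size of N makes \<beta> > 1, so that the weight is continuous.\<close>
  obtain N :: nat where "real N > \<alpha> + 3/2" using reals_Archimedean2 by blast
  define \<beta> where "\<beta> = real N - \<alpha> - 1/2"
  have \<beta>: "\<beta> > 1" using \<open>real N > \<alpha> + 3/2\<close> by (simp add: \<beta>_def)
  have N: "\<alpha> + \<beta> + 1/2 = real N" by (simp add: \<beta>_def)
  \<comment> \<open>The value, independent of n, that \<open>bs_moment_inverse\<close> assigns to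
    the product of the two moments and the Pochhammer symbol.\<close>
  define \<kappa> where "\<kappa> = bs_const \<alpha> * Gamma (\<alpha> + 1/2) * Gamma \<beta> / 4"
  have "Gamma (\<alpha> + 1/2) > 0" "Gamma \<beta> > 0" by (rule Gamma_real_pos; use \<alpha> \<beta> in simp)+
  then have \<kappa>: "\<kappa> \<noteq> 0" using bs_const_pos[OF \<alpha>] by (simp add: \<kappa>_def)
  define a where "a n = (deriv ^^ n) F 0 / fact n" for n
  have "F holomorphic_on UNIV" using F by (simp add: paley_wiener_def)
  then have hol: "F holomorphic_on ball 0 r" for r using holomorphic_on_subset by blast
  have aF: "(\<lambda>n. a n * z ^ n) sums F z" for z
    using holomorphic_power_series[OF hol, of z "norm z + 1"] by (simp add: a_def)
  obtain H where H: "paley_wiener b H"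
    "\<And>z. (\<lambda>n. of_real (pochhammer ((real n + 1) / 2) N) * a n * z ^ n) sums H z"
    using paley_wiener_pochhammer[OF b F aF] by blast
  obtain S m C where S: "linear_functional S" "seminorm_bounded S b m C"
    and SH: "\<And>z. S (\<lambda>x. exp (- \<i> * z * of_real x)) = H z"
    using paley_wiener_fourier_rep[OF b H(1)] unfolding fourier_rep_def by blast
  have Sc: "S \<in> compact_distributions" by (rule bounded_imp_compact_distribution[OF S(1) b S(2)])
  \<comment> \<open>Both sides are the n-th Taylor coefficient of H, which reads off the moments of
    \<open>S\<close>.\<close>
  have coeff: "S (\<lambda>x. of_real x ^ n) / fact n * (- \<i>) ^ n = of_real (pochhammer ((real n + 1) / 2) N) * a n" for n
  proof (rule power_series_unique[OF _ H(2)])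
    fix z
    from distribution_exp_sums[OF Sc, of "- \<i> * z"]
    show "(\<lambda>n. S (\<lambda>x. of_real x ^ n) / fact n * (- \<i>) ^ n * z ^ n) sums H z"
      unfolding SH power_mult_distrib by (simp only: mult.assoc)
  qed
  let ?v = "erdelyi_weight \<alpha> \<beta>"
  have v: "continuous_on {0..1} ?v" by (rule erdelyi_weight_continuous[OF \<alpha> \<beta>])
  obtain V where V: "seminorm_bounded (\<lambda>f. S (dilate ?v f)) b m (C * V)"
    using dilate_functional(2)[OF S v] by blast
  define T where "T f = 1 / of_real \<kappa> * S (dilate ?v f)" for f
  have Tl: "linear_functional T"
    using dilate_functional(1)[OF S v] unfolding linear_functional_def T_def by (auto simp: algebra_simps)
  have Tb: "seminorm_bounded T b m (norm (1 / complex_of_real \<kappa>) * (C * V))"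
    unfolding seminorm_bounded_def
  proof (intro ballI allI impI)
    fix f B assume f: "f \<in> smooth_functions" "\<forall>k\<le>m. \<forall>x\<in>{-b..b}. norm (nth_deriv k f x) \<le> B"
    have "norm (S (dilate ?v f)) \<le> C * V * B"
      by (rule seminorm_boundedD[OF V f(1)]) (use f(2) in blast)
    then show "norm (T f) \<le> norm (1 / complex_of_real \<kappa>) * (C * V) * B"
      unfolding T_def norm_mult mult.assoc by (intro mult_left_mono) auto
  qed
  have Tc: "T \<in> compact_distributions" by (rule bounded_imp_compact_distribution[OF Tl b Tb])
  have "T (bessel_struve_kernel \<alpha> (- \<i> * z)) = F z" for z
  proof -
    define d where "d n = Beta (real n / 2 + \<alpha> + 1) \<beta> / 2" for n
    \<comment> \<open>Monomials are eigenfunctions of the dilation mean, with eigenvalue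
      \<open>d n\<close>.\<close>
    have Tn: "T (\<lambda>x. of_real x ^ n) = 1 / of_real \<kappa> * (of_real (d n) * S (\<lambda>x. of_real x ^ n))" for n
      unfolding T_def dilate_monomial[OF v] erdelyi_weight_moment[OF \<alpha> \<beta>] d_def
      by (simp only: linear_functional_scale[OF S(1) smooth_monomial])
    have "of_real (bs_const \<alpha> * bs_moment \<alpha> n / fact n) * T (\<lambda>x. of_real x ^ n) * (- \<i> * z) ^ n = a n * z ^ n" for n
    proof -
      have "of_real (bs_const \<alpha> * bs_moment \<alpha> n / fact n) * T (\<lambda>x. of_real x ^ n) * (- \<i> * z) ^ n
        = of_real (bs_const \<alpha> * bs_moment \<alpha> n * d n / \<kappa>) *
          (S (\<lambda>x. of_real x ^ n) / fact n * (- \<i>) ^ n) * z ^ n"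
        unfolding Tn power_mult_distrib by (simp add: mult_ac)
      also have "\<dots> = of_real (bs_const \<alpha> * bs_moment \<alpha> n * d n * pochhammer ((real n + 1) / 2) N / \<kappa>) * a n * z ^ n"
        unfolding coeff by simp
      also have "bs_const \<alpha> * bs_moment \<alpha> n * d n * pochhammer ((real n + 1) / 2) N = \<kappa>"
        unfolding d_def \<kappa>_def by (rule bs_moment_inverse[OF \<alpha> \<beta> N])
      finally show ?thesis using \<kappa> by simp
    qed
    with distribution_kernel_sums[OF \<alpha> Tc, of "- \<i> * z"]
    have "(\<lambda>n. a n * z ^ n) sums T (bessel_struve_kernel \<alpha> (- \<i> * z))" by simp
    then show ?thesis using aF sums_unique2 by blast
  qed
  then show ?thesis using that[OF Tc bounded_imp_support[OF Tb]] by blast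
qed

section \<open>The equivalence\<close>

theorem theorem4p3:
  fixes \<alpha> b :: real and f :: "real \<Rightarrow> complex"
  assumes "\<alpha> > -1/2" and "b > 0" and "f \<in> smooth_functions"
  shows "(\<exists>T \<in> compact_distributions.
            distribution_support T \<subseteq> {-b..b} \<and> f = bessel_struve_transform \<alpha> T)
     \<longleftrightarrow> (\<exists>F :: complex \<Rightarrow> complex.
            F analytic_on UNIV \<and> (\<forall>x::real. F (of_real x) = f x) \<and>
            (\<exists>m::nat. \<exists>c::real. c > 0 \<and>
               (\<forall>z. norm (F z) \<le> c * (1 + (norm z)\<^sup>2) powr (real m / 2) * exp (b * \<bar>Im z\<bar>))))"
    (is "?L \<longleftrightarrow> ?R")
proof
  assume ?L
  then obtain T where T: "T \<in> compact_distributions" "distribution_support T \<subseteq> {-b..b}"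
    "f = bessel_struve_transform \<alpha> T" by blast
  define F where "F z = T (bessel_struve_kernel \<alpha> (- \<i> * z))" for z
  have "F analytic_on UNIV" unfolding F_def by (rule transform_entire[OF assms(1) T(1)])
  moreover have "\<forall>x::real. F (of_real x) = f x"
    unfolding F_def T(3) bessel_struve_transform_def by simp
  moreover obtain m c where "c > 0"
    "\<And>z. norm (F z) \<le> c * (1 + (norm z)\<^sup>2) powr (real m / 2) * exp (b * \<bar>Im z\<bar>)"
    unfolding F_def using distribution_kernel_growth[OF assms(1,2) T(1,2)] by blast
  ultimately show ?R by blast
next
  assume ?R
  then obtain F m c where F: "F analytic_on UNIV" "\<And>x::real. F (of_real x) = f x" "c > 0"
    "\<And>z. norm (F z) \<le> c * (1 + (norm z)\<^sup>2) powr (real m / 2) * exp (b * \<bar>Im z\<bar>)" by blast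
  have "norm (F z) \<le> c * (1 + norm z) ^ m * exp (b * \<bar>Im z\<bar>)" for z
  proof -
    \<comment> \<open>1 + r^2 \<le> (1 + r)^2 for r \<ge> 0 passes to the growth condition in powers
      of 1 + |z|.\<close>
    have "(1 + (norm z)\<^sup>2) powr (real m / 2) \<le> ((1 + norm z) powr 2) powr (real m / 2)"
      by (rule powr_mono2) (auto simp: power2_sum)
    also have "\<dots> = (1 + norm z) ^ m"
      unfolding powr_powr by (simp add: powr_realpow add_pos_nonneg)
    finally have "c * (1 + (norm z)\<^sup>2) powr (real m / 2) * exp (b * \<bar>Im z\<bar>) \<le>
        c * (1 + norm z) ^ m * exp (b * \<bar>Im z\<bar>)"
      using F(3) by (intro mult_right_mono mult_left_mono) auto
    with F(4)[of z] show ?thesis by (rule order_trans)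
  qed
  moreover have "F holomorphic_on UNIV" using F(1) by (rule analytic_imp_holomorphic)
  ultimately have "paley_wiener b F" unfolding paley_wiener_def by blast
  from paley_wiener_distribution[OF assms(1,2) this]
  obtain T where T: "T \<in> compact_distributions" "distribution_support T \<subseteq> {-b..b}"
    "\<And>z. T (bessel_struve_kernel \<alpha> (- \<i> * z)) = F z" by blast
  moreover have "f = bessel_struve_transform \<alpha> T"
    unfolding bessel_struve_transform_def T(3) F(2) ..
  ultimately show ?L by blast
qed

end
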